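(* Let $1\le k\le d$ and let $q$ be odd. If $E\subseteq\mathbb{F}_q^d$ is $(4,s)$-Salem, then \[ \#T_k^d(E)\gtrsim\min\Big\{q^{\binom{k+1}{2}},\ (\#E)^{k-1+4s}q^{\binom{k+1}{2}-kd}\Big\}. \] In particular, if $\#E\gtrsim q^{\frac{kd}{k+1}}$ and $E$ is $(4,1/2)$-Salem, then $\#T_k^d(E)\gtrsim q^{\binom{k+1}{2}}$.
   Context: $q$ is a prime power, $\chi$ a fixed non-trivial additive character of $\mathbb{F}_q$. $\widehat E(x)=q^{-d}\sum_{y\in E}\chi(-x\cdot y)$, $\|\widehat E\|_4=\big(q^{-d}\sum_{x\ne0}|\widehat E(x)|^4\big)^{1/4}$. Sets are families indexed by $q$; $A\lesssim B$ means $A\le cB$ with $c$ independent of $q$. $E$ is $(4,s)$-Salem if $\|\widehat E\|_4\lesssim q^{-d}(\#E)^{1-s}$. A $k$-simplex in $E$ is given by its vertices $(x_1,\dots,x_{k+1})\in E^{k+1}$; two $k$-simplices $(x_1,\dots,x_{k+1})$ and $(y_1,\dots,y_{k+1})$ are congruent if there is a rigid motion $A\in\mathbb{F}_q^d\rtimes O_d(\mathbb{F}_q)$ (a map $x\mapsto Ox+b$ with $b\in\mathbb{F}_q^d$ and $O$ an orthogonal matrix over $\mathbb{F}_q$, $O^TO=I$) with $A(x_i)=y_i$ for all $i$. $T_k^d(E)$ denotes the set of congruence classes of $k$-simplices determined by $E$. *)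

theory Defs
  imports Complex_Main "HOL-Algebra.Coset" "HOL-Algebra.Ring"
begin

text \<open>
  Finite fields are fields in the sense of HOL-Algebra, so that one statement can range over
  infinitely many of them, and a constant can be uniform in the cardinality \<open>q = order R\<close>.
  Vectors of \<open>R\<^sup>d\<close> are extensional functions on \<open>{..<d}\<close>.
\<close>

definition vectors :: "('a, 'b) ring_scheme \<Rightarrow> nat \<Rightarrow> (nat \<Rightarrow> 'a) set" where
  "vectors R d = {..<d} \<rightarrow>\<^sub>E carrier R"

definition zero_vector :: "('a, 'b) ring_scheme \<Rightarrow> nat \<Rightarrow> nat \<Rightarrow> 'a" where
  "zero_vector R d = (\<lambda>i\<in>{..<d}. \<zero>\<^bsub>R\<^esub>)"

definition dot_product ::
    "('a, 'b) ring_scheme \<Rightarrow> nat \<Rightarrow> (nat \<Rightarrow> 'a) \<Rightarrow> (nat \<Rightarrow> 'a) \<Rightarrow> 'a" where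
  "dot_product R d x y = (\<Oplus>\<^bsub>R\<^esub>i\<in>{..<d}. x i \<otimes>\<^bsub>R\<^esub> y i)"

definition nontrivial_additive_character ::
    "('a, 'b) ring_scheme \<Rightarrow> ('a \<Rightarrow> complex) \<Rightarrow> bool" where
  "nontrivial_additive_character R \<chi> \<longleftrightarrow>
     (\<forall>a\<in>carrier R. cmod (\<chi> a) = 1) \<and>
     (\<forall>a\<in>carrier R. \<forall>b\<in>carrier R. \<chi> (a \<oplus>\<^bsub>R\<^esub> b) = \<chi> a * \<chi> b) \<and>
     (\<exists>a\<in>carrier R. \<chi> a \<noteq> 1)"

definition fourier_transform ::
    "('a, 'b) ring_scheme \<Rightarrow> ('a \<Rightarrow> complex) \<Rightarrow> nat \<Rightarrow> (nat \<Rightarrow> 'a) set \<Rightarrow> (nat \<Rightarrow> 'a) \<Rightarrow> complex"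
  where
  "fourier_transform R \<chi> d E x =
     (\<Sum>y\<in>E. \<chi> (\<ominus>\<^bsub>R\<^esub> dot_product R d x y)) / of_nat (order R) ^ d"

definition fourier_norm4 ::
    "('a, 'b) ring_scheme \<Rightarrow> ('a \<Rightarrow> complex) \<Rightarrow> nat \<Rightarrow> (nat \<Rightarrow> 'a) set \<Rightarrow> real" where
  "fourier_norm4 R \<chi> d E =
     ((\<Sum>x\<in>vectors R d - {zero_vector R d}. cmod (fourier_transform R \<chi> d E x) ^ 4)
        / real (order R) ^ d) powr (1/4)"

text \<open>
  The relation \<open>f \<lesssim> g\<close> for quantities depending on a member of a family with index set \<open>I\<close>:
  the implied constant is the same for all members, in particular for all \<open>q\<close>.
\<close>

definition lesssim :: "'i set \<Rightarrow> ('i \<Rightarrow> real) \<Rightarrow> ('i \<Rightarrow> real) \<Rightarrow> bool" where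
  "lesssim I f g \<longleftrightarrow> (\<exists>c>0. \<forall>i\<in>I. f i \<le> c * g i)"

definition salem4 ::
    "'i set \<Rightarrow> ('i \<Rightarrow> 'a ring) \<Rightarrow> ('i \<Rightarrow> 'a \<Rightarrow> complex) \<Rightarrow> nat \<Rightarrow> real \<Rightarrow>
     ('i \<Rightarrow> (nat \<Rightarrow> 'a) set) \<Rightarrow> bool" where
  "salem4 I F \<chi> d s E \<longleftrightarrow>
     lesssim I (\<lambda>i. fourier_norm4 (F i) (\<chi> i) d (E i))
       (\<lambda>i. real (order (F i)) powr (- real d) * real (card (E i)) powr (1 - s))"

definition orthogonal_matrix ::
    "('a, 'b) ring_scheme \<Rightarrow> nat \<Rightarrow> (nat \<Rightarrow> nat \<Rightarrow> 'a) \<Rightarrow> bool" where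
  "orthogonal_matrix R d M \<longleftrightarrow>
     (\<forall>i<d. \<forall>j<d. M i j \<in> carrier R) \<and>
     (\<forall>i<d. \<forall>j<d. (\<Oplus>\<^bsub>R\<^esub>l\<in>{..<d}. M l i \<otimes>\<^bsub>R\<^esub> M l j) = (if i = j then \<one>\<^bsub>R\<^esub> else \<zero>\<^bsub>R\<^esub>))"

definition affine_map ::
    "('a, 'b) ring_scheme \<Rightarrow> nat \<Rightarrow> (nat \<Rightarrow> nat \<Rightarrow> 'a) \<Rightarrow> (nat \<Rightarrow> 'a) \<Rightarrow> (nat \<Rightarrow> 'a) \<Rightarrow> nat \<Rightarrow> 'a"
  where
  "affine_map R d M b x = (\<lambda>i\<in>{..<d}. (\<Oplus>\<^bsub>R\<^esub>j\<in>{..<d}. M i j \<otimes>\<^bsub>R\<^esub> x j) \<oplus>\<^bsub>R\<^esub> b i)"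

text \<open>A \<open>k\<close>-simplex is any \<open>(k+1)\<close>-tuple of points, with vertices indexed by \<open>{..k}\<close>.\<close>

definition simplices :: "nat \<Rightarrow> (nat \<Rightarrow> 'a) set \<Rightarrow> (nat \<Rightarrow> nat \<Rightarrow> 'a) set" where
  "simplices k E = {..k} \<rightarrow>\<^sub>E E"

definition congruent_simplices ::
    "('a, 'b) ring_scheme \<Rightarrow> nat \<Rightarrow> nat \<Rightarrow> (nat \<Rightarrow> nat \<Rightarrow> 'a) \<Rightarrow> (nat \<Rightarrow> nat \<Rightarrow> 'a) \<Rightarrow> bool" where
  "congruent_simplices R d k x y \<longleftrightarrow>
     (\<exists>M b. orthogonal_matrix R d M \<and> b \<in> vectors R d \<and> (\<forall>i\<le>k. affine_map R d M b (x i) = y i))"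

definition congruence_classes ::
    "('a, 'b) ring_scheme \<Rightarrow> nat \<Rightarrow> nat \<Rightarrow> (nat \<Rightarrow> 'a) set \<Rightarrow> (nat \<Rightarrow> nat \<Rightarrow> 'a) set set" where
  "congruence_classes R d k E =
     simplices k E //
       {(x, y). x \<in> simplices k E \<and> y \<in> simplices k E \<and> congruent_simplices R d k x y}"

end

theory Submission
  imports Defs "HOL-Algebra.Multiplicative_Group"
begin

text \<open>
  By Cauchy--Schwarz over the congruence classes it suffices to bound the number of congruent pairs
  of simplices. The rigid motions realizing a congruence correspond to the pointwise stabilizer, in
  the orthogonal group, of the edge vectors at one vertex. Adding these vectors one at a time, each
  orbit lies on a quadric in an affine space, so the stabilizer makes up at least a fraction
  \<open>1 / (2 ^ k * q ^ (k * d - (k + 1 choose 2)))\<close> of the group.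

  For a fixed orthogonal \<open>g\<close> let \<open>\<lambda>(b)\<close> be the number of points \<open>u\<close> of \<open>E\<close> with \<open>g u + b\<close>
  in \<open>E\<close>; congruent pairs amount to the moments \<open>\<Sum>b. \<lambda>(b) ^ (k + 1)\<close>. The mean of \<open>\<lambda>\<close> is
  \<open>(#E)\<^sup>2 / q ^ d\<close>, and by Plancherel and AM--GM its variance is at most the fourth moment of the
  Fourier transform of \<open>E\<close> off the origin, uniformly in \<open>g\<close>. Since \<open>\<lambda> \<le> #E\<close>, this controls all higher
  moments.
\<close>

section \<open>Cauchy--Schwarz for the classes of an equivalence relation\<close>

lemma sum_squared_le_card:
  fixes f :: "'b \<Rightarrow> real"
  assumes "finite A"
  shows "(\<Sum>x\<in>A. f x)\<^sup>2 \<le> real (card A) * (\<Sum>x\<in>A. (f x)\<^sup>2)"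
proof -
  \<comment> \<open>Lagrange's identity: the defect in Cauchy--Schwarz against the constant function
    1 is half the sum of the squared differences over all ordered pairs.\<close>
  have "0 \<le> (\<Sum>x\<in>A. \<Sum>y\<in>A. (f x - f y)\<^sup>2)"
    by (intro sum_nonneg) auto
  also have "\<dots> = 2 * (real (card A) * (\<Sum>x\<in>A. (f x)\<^sup>2)) - 2 * (\<Sum>x\<in>A. f x)\<^sup>2"
    by (simp add: power2_diff sum.distrib sum_subtractf power2_eq_square [of "sum f A"] sum_product
        sum_distrib_left mult_ac)
  finally show ?thesis by simp
qed

text \<open>The classes partition \<open>A\<close>, and \<open>r\<close> is the disjoint union of
  the squares \<open>C \<times> C\<close> of the classes. The two cardinalities are therefore the
  first and second moments of the class sizes. Applied to congruence, this turns an upper bound for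
  congruent pairs into a lower bound for classes.\<close>

lemma card_squared_le_quotient:
  assumes r: "equiv A r" and A: "finite A"
  shows "(real (card A))\<^sup>2 \<le> real (card (A // r)) * real (card r)"
proof -
  have fin: "finite (A // r)"
    using A r by (simp add: finite_quotient equiv_type)
  have finC: "finite C" if "C \<in> A // r" for C
    using that A r by (meson finite_equiv_class equiv_type)
  have disj: "C \<inter> C' = {}" if "C \<in> A // r" "C' \<in> A // r" "C \<noteq> C'" for C C'
    using quotient_disj [OF r that(1,2)] that(3) by blast
  have "A = \<Union>(A // r)"
    using r by (simp add: Union_quotient)
  then have cA: "card A = (\<Sum>C\<in>A // r. card C)"
    using card_Union_disjoint [of "A // r"] finC disj by (auto simp: pairwise_def disjnt_def)
  have "r = (\<Union>C\<in>A // r. C \<times> C)"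
  proof (intro equalityI subrelI)
    fix a b assume ab: "(a, b) \<in> r"
    then have "a \<in> A"
      using equiv_type [OF r] by blast
    then have "r `` {a} \<in> A // r" "a \<in> r `` {a}"
      using equiv_class_self [OF r] by (auto intro: quotientI)
    then show "(a, b) \<in> (\<Union>C\<in>A // r. C \<times> C)"
      using ab by blast
  next
    fix a b assume "(a, b) \<in> (\<Union>C\<in>A // r. C \<times> C)"
    then obtain c where "(c, a) \<in> r" "(c, b) \<in> r"
      by (auto elim!: quotientE)
    then show "(a, b) \<in> r"
      using r by (meson equivE symD transD)
  qed
  then have "card r = card (\<Union>C\<in>A // r. C \<times> C)"
    by simp
  also have "\<dots> = (\<Sum>C\<in>A // r. card (C \<times> C))"
    using fin finC disj by (intro card_UN_disjoint) blast+
  finally have "real (card r) = (\<Sum>C\<in>A // r. (real (card C))\<^sup>2)"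
    by (simp add: card_cartesian_product power2_eq_square)
  then show ?thesis
    using sum_squared_le_card [OF fin, of "\<lambda>C. real (card C)"] cA by simp
qed

lemma powr_quarter_power4:
  fixes a :: real
  assumes "a \<ge> 0" shows "(a powr (1/4)) ^ 4 = a"
  using assms powr_realpow [of "a powr (1/4)" 4] by (cases "a = 0") (simp_all add: powr_powr)

section \<open>Vectors over a finite field\<close>

locale finite_field_space = field R for R (structure) +
  fixes d :: nat
  assumes finite_carrier: "finite (carrier R)"
begin

abbreviation V :: "(nat \<Rightarrow> 'a) set" where "V \<equiv> vectors R d"

abbreviation dot :: "(nat \<Rightarrow> 'a) \<Rightarrow> (nat \<Rightarrow> 'a) \<Rightarrow> 'a" (infixl "\<bullet>" 75) where
  "x \<bullet> y \<equiv> dot_product R d x y"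

abbreviation zv :: "nat \<Rightarrow> 'a" where "zv \<equiv> zero_vector R d"

text \<open>The operations restrict their results to \<open>{..<d}\<close>, which keeps them
  extensional: vectors with the same coordinates are then equal as functions.\<close>

definition vadd :: "(nat \<Rightarrow> 'a) \<Rightarrow> (nat \<Rightarrow> 'a) \<Rightarrow> nat \<Rightarrow> 'a" where
  "vadd x y = (\<lambda>i\<in>{..<d}. x i \<oplus> y i)"

definition vsub :: "(nat \<Rightarrow> 'a) \<Rightarrow> (nat \<Rightarrow> 'a) \<Rightarrow> nat \<Rightarrow> 'a" where
  "vsub x y = (\<lambda>i\<in>{..<d}. x i \<ominus> y i)"

definition smul :: "'a \<Rightarrow> (nat \<Rightarrow> 'a) \<Rightarrow> nat \<Rightarrow> 'a" where
  "smul c x = (\<lambda>i\<in>{..<d}. c \<otimes> x i)"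

definition unit_vector :: "nat \<Rightarrow> nat \<Rightarrow> 'a" where
  "unit_vector j = (\<lambda>i\<in>{..<d}. if i = j then \<one> else \<zero>)"

lemma vector_comp [simp, intro]: "x \<in> V \<Longrightarrow> i < d \<Longrightarrow> x i \<in> carrier R"
  unfolding vectors_def by auto

lemma finite_V [simp]: "finite V"
  unfolding vectors_def using finite_carrier by (simp add: finite_PiE)

lemma card_V: "card V = order R ^ d"
  unfolding vectors_def order_def by (simp add: card_PiE)

lemma vector_eqI: "x \<in> V \<Longrightarrow> y \<in> V \<Longrightarrow> (\<And>i. i < d \<Longrightarrow> x i = y i) \<Longrightarrow> x = y"
  unfolding vectors_def by (rule PiE_ext) auto

lemma vec_closed [simp, intro]:
  "x \<in> V \<Longrightarrow> y \<in> V \<Longrightarrow> vadd x y \<in> V"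
  "x \<in> V \<Longrightarrow> y \<in> V \<Longrightarrow> vsub x y \<in> V"
  "x \<in> V \<Longrightarrow> c \<in> carrier R \<Longrightarrow> smul c x \<in> V"
  "zv \<in> V"
  "unit_vector j \<in> V"
  by (auto simp: vectors_def vadd_def vsub_def smul_def zero_vector_def unit_vector_def PiE_iff
      intro!: a_closed minus_closed)

lemma vec_nth [simp]:
  "i < d \<Longrightarrow> vadd x y i = x i \<oplus> y i"
  "i < d \<Longrightarrow> vsub x y i = x i \<ominus> y i"
  "i < d \<Longrightarrow> smul c x i = c \<otimes> x i"
  "i < d \<Longrightarrow> zv i = \<zero>"
  by (auto simp: vadd_def vsub_def smul_def zero_vector_def)

lemma dot_closed [simp, intro]: "x \<in> V \<Longrightarrow> y \<in> V \<Longrightarrow> x \<bullet> y \<in> carrier R"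
  unfolding dot_product_def by (rule finsum_closed) auto

lemma dot_commute: "x \<in> V \<Longrightarrow> y \<in> V \<Longrightarrow> x \<bullet> y = y \<bullet> x"
  unfolding dot_product_def by (rule finsum_cong') (auto simp: m_comm)

lemma dot_add_left:
  assumes "x \<in> V" "y \<in> V" "z \<in> V" shows "vadd x y \<bullet> z = x \<bullet> z \<oplus> y \<bullet> z"
proof -
  have "vadd x y \<bullet> z = (\<Oplus>i\<in>{..<d}. x i \<otimes> z i \<oplus> y i \<otimes> z i)"
    unfolding dot_product_def using assms by (intro finsum_cong') (auto simp: l_distr)
  also have "\<dots> = x \<bullet> z \<oplus> y \<bullet> z"
    unfolding dot_product_def using assms by (intro finsum_addf) auto
  finally show ?thesis .
qed

lemma dot_smul_left: "x \<in> V \<Longrightarrow> z \<in> V \<Longrightarrow> c \<in> carrier R \<Longrightarrow> smul c x \<bullet> z = c \<otimes> (x \<bullet> z)"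
  unfolding dot_product_def
  by (subst finsum_rdistr) (auto simp: smul_def m_assoc intro!: finsum_cong')

lemma vadd_vsub [simp]: "x \<in> V \<Longrightarrow> y \<in> V \<Longrightarrow> vadd (vsub x y) y = x"
  by (rule vector_eqI) (auto simp: minus_eq a_assoc l_neg)

lemma vsub_vadd [simp]: "x \<in> V \<Longrightarrow> y \<in> V \<Longrightarrow> vsub (vadd x y) y = x"
  by (rule vector_eqI) (auto simp: minus_eq a_assoc r_neg)

lemma vadd_commute: "x \<in> V \<Longrightarrow> y \<in> V \<Longrightarrow> vadd x y = vadd y x"
  by (rule vector_eqI) (auto simp: a_comm)

lemma vadd_assoc: "x \<in> V \<Longrightarrow> y \<in> V \<Longrightarrow> z \<in> V \<Longrightarrow> vadd (vadd x y) z = vadd x (vadd y z)"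
  by (rule vector_eqI) (auto simp: a_assoc)

lemma vsub_eq_zero_iff: "x \<in> V \<Longrightarrow> y \<in> V \<Longrightarrow> vsub x y = zv \<longleftrightarrow> x = y"
proof
  assume xy: "x \<in> V" "y \<in> V" and eq: "vsub x y = zv"
  show "x = y"
  proof (rule vector_eqI [OF xy])
    fix i assume i: "i < d"
    then have "x i \<ominus> y i = \<zero>"
      using fun_cong [OF eq, of i] by simp
    then show "x i = y i"
      using xy i by (metis minus_equality minus_minus minus_eq a_inv_closed vector_comp a_comm)
  qed
next
  assume "x \<in> V" "y \<in> V" "x = y"
  then show "vsub x y = zv"
    by (intro vector_eqI) (auto simp: minus_eq r_neg)
qed

lemma dot_add_right: "x \<in> V \<Longrightarrow> y \<in> V \<Longrightarrow> z \<in> V \<Longrightarrow> z \<bullet> vadd x y = z \<bullet> x \<oplus> z \<bullet> y"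
  by (metis dot_add_left dot_commute vec_closed(1))

lemma dot_smul_right: "x \<in> V \<Longrightarrow> z \<in> V \<Longrightarrow> c \<in> carrier R \<Longrightarrow> z \<bullet> smul c x = c \<otimes> (z \<bullet> x)"
  by (metis dot_smul_left dot_commute vec_closed(3))

lemma dot_sub_left:
  assumes "x \<in> V" "y \<in> V" "z \<in> V" shows "vsub x y \<bullet> z = x \<bullet> z \<ominus> y \<bullet> z"
proof -
  have "x \<bullet> z = vsub x y \<bullet> z \<oplus> y \<bullet> z"
    using assms by (subst dot_add_left [symmetric]) auto
  then show ?thesis
    using assms by (simp add: minus_eq a_assoc r_neg)
qed

lemma dot_sub_right:
  assumes "x \<in> V" "y \<in> V" "z \<in> V" shows "z \<bullet> vsub x y = z \<bullet> x \<ominus> z \<bullet> y"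
  using assms by (metis dot_sub_left dot_commute vec_closed(2))

lemma dot_zero_left [simp]: "x \<in> V \<Longrightarrow> zv \<bullet> x = \<zero>"
  unfolding dot_product_def zero_vector_def
  by (subst finsum_cong' [where g = "\<lambda>_. \<zero>"]) auto

lemma dot_zero_right [simp]: "x \<in> V \<Longrightarrow> x \<bullet> zv = \<zero>"
  by (metis dot_zero_left dot_commute vec_closed(4))

lemma dot_unit_vector [simp]: 
  assumes "x \<in> V" "j < d" shows "x \<bullet> unit_vector j = x j"
proof -
  have "x \<bullet> unit_vector j = (\<Oplus>i\<in>{..<d}. if j = i then x i else \<zero>)"
    unfolding dot_product_def unit_vector_def using assms by (intro finsum_cong') auto
  also have "\<dots> = x j"
    using assms by (intro add.finprod_singleton) auto
  finally show ?thesis .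
qed

text \<open>Testing against the unit vectors recovers the coordinates. Identities between vectors,
  in particular the linearity of isometries, are derived from this instead of from a basis
  expansion.\<close>

lemma dot_nondegenerate:
  assumes "x \<in> V" "y \<in> V" "\<And>z. z \<in> V \<Longrightarrow> x \<bullet> z = y \<bullet> z" shows "x = y"
  using assms by (intro vector_eqI) (metis dot_unit_vector vec_closed(5))+

lemma bij_vadd: "a \<in> V \<Longrightarrow> bij_betw (\<lambda>x. vadd x a) V V"
  by (rule bij_betw_byWitness [where f' = "\<lambda>x. vsub x a"]) auto

text \<open>The vector on the left is the matrix with columns \<open>v j\<close> applied to the
  coefficients \<open>c\<close>. Both passages between orthogonal matrices and isometries rest on
  this expansion.\<close>

lemma dot_finsum_left:
  assumes "finite A" "\<And>j. j \<in> A \<Longrightarrow> c j \<in> carrier R" "\<And>j. j \<in> A \<Longrightarrow> v j \<in> V" "z \<in> V"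
  shows "(\<lambda>i\<in>{..<d}. \<Oplus>j\<in>A. v j i \<otimes> c j) \<bullet> z = (\<Oplus>j\<in>A. c j \<otimes> (v j \<bullet> z))"
    and "(\<lambda>i\<in>{..<d}. \<Oplus>j\<in>A. v j i \<otimes> c j) \<in> V"
proof -
  show V: "(\<lambda>i\<in>{..<d}. \<Oplus>j\<in>A. v j i \<otimes> c j) \<in> V"
    using assms by (auto simp: vectors_def PiE_iff intro!: finsum_closed)
  show "(\<lambda>i\<in>{..<d}. \<Oplus>j\<in>A. v j i \<otimes> c j) \<bullet> z = (\<Oplus>j\<in>A. c j \<otimes> (v j \<bullet> z))"
    using assms
  proof (induction A)
    case empty
    then show ?case by (metis (no_types, lifting) dot_zero_left finsum_empty zero_vector_def restrict_ext)
  next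
    case (insert a A)
    let ?w = "(\<lambda>i\<in>{..<d}. \<Oplus>j\<in>A. v j i \<otimes> c j)"
    have w: "?w \<in> V"
      using insert by (auto simp: vectors_def PiE_iff intro!: finsum_closed)
    have "(\<lambda>i\<in>{..<d}. \<Oplus>j\<in>insert a A. v j i \<otimes> c j) = vadd (smul (c a) (v a)) ?w"
      using insert by (auto simp: vadd_def smul_def fun_eq_iff m_comm intro!: finsum_insert [THEN trans])
    then show ?case
      using insert w by (simp add: dot_add_left dot_smul_left finsum_insert Pi_def del: restrict_apply)
  qed
qed

section \<open>The orthogonal group\<close>

text \<open>
  The orthogonal group as a set of extensional maps: preserving the dot product already forces a
  self-map of \<open>V\<close> to be linear.
\<close>

definition G :: "((nat \<Rightarrow> 'a) \<Rightarrow> nat \<Rightarrow> 'a) set" where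
  "G = {g \<in> V \<rightarrow>\<^sub>E V. \<forall>x\<in>V. \<forall>y\<in>V. g x \<bullet> g y = x \<bullet> y}"

lemma G_closed [simp, intro]: "g \<in> G \<Longrightarrow> x \<in> V \<Longrightarrow> g x \<in> V"
  unfolding G_def by auto

lemma G_dot [simp]: "g \<in> G \<Longrightarrow> x \<in> V \<Longrightarrow> y \<in> V \<Longrightarrow> g x \<bullet> g y = x \<bullet> y"
  unfolding G_def by auto

lemma G_I: "(\<And>x. x \<in> V \<Longrightarrow> g x \<in> V) \<Longrightarrow> (\<And>x y. x \<in> V \<Longrightarrow> y \<in> V \<Longrightarrow> g x \<bullet> g y = x \<bullet> y) \<Longrightarrow>
    restrict g V \<in> G"
  unfolding G_def by auto

lemma G_eqI: "g \<in> G \<Longrightarrow> h \<in> G \<Longrightarrow> (\<And>x. x \<in> V \<Longrightarrow> g x = h x) \<Longrightarrow> g = h"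
  unfolding G_def by (auto intro: PiE_ext)

lemma finite_G [simp]: "finite G"
  by (rule finite_subset [of _ "V \<rightarrow>\<^sub>E V"]) (auto simp: G_def finite_PiE)

text \<open>Nondegeneracy makes a map that preserves the dot product injective, and finiteness of
  \<open>V\<close> then makes it surjective.\<close>

lemma G_bij: 
  assumes g: "g \<in> G" shows "bij_betw g V V"
proof -
  have "inj_on g V"
  proof (rule inj_onI)
    fix x y assume "x \<in> V" "y \<in> V" "g x = g y"
    then show "x = y"
      using g by (intro dot_nondegenerate) (metis G_dot)+
  qed
  moreover have "g ` V \<subseteq> V"
    using g by auto
  ultimately show ?thesis
    by (simp add: bij_betw_def endo_inj_surj)
qed

lemma G_surj: "g \<in> G \<Longrightarrow> y \<in> V \<Longrightarrow> \<exists>x\<in>V. g x = y"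
  using G_bij by (metis bij_betw_def imageE)

text \<open>Since \<open>g\<close> is onto, testing against the images \<open>g z\<close> is enough.
  On such images \<open>g\<close> can be stripped off both factors of a dot product, and this is how
  additivity follows from the mere preservation of dot products.\<close>

lemma G_nondegenerate:
  assumes "g \<in> G" "x \<in> V" "y \<in> V" "\<And>z. z \<in> V \<Longrightarrow> x \<bullet> g z = y \<bullet> g z" shows "x = y"
  using assms by (intro dot_nondegenerate) (metis G_surj)+

lemma G_add: "g \<in> G \<Longrightarrow> x \<in> V \<Longrightarrow> y \<in> V \<Longrightarrow> g (vadd x y) = vadd (g x) (g y)"
  by (rule G_nondegenerate [of g]) (auto simp: dot_add_left)

lemma G_sub: "g \<in> G \<Longrightarrow> x \<in> V \<Longrightarrow> y \<in> V \<Longrightarrow> g (vsub x y) = vsub (g x) (g y)"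
  by (rule G_nondegenerate [of g]) (auto simp: dot_sub_left)

lemma G_zero: "g \<in> G \<Longrightarrow> g zv = zv"
  by (rule G_nondegenerate [of g]) auto

lemma G_id: "restrict id V \<in> G"
  by (rule G_I) auto

lemma G_compose: "g \<in> G \<Longrightarrow> h \<in> G \<Longrightarrow> compose V g h \<in> G"
  unfolding compose_def by (rule G_I) auto

lemma G_inverse: 
  assumes "g \<in> G" obtains h where "h \<in> G" "\<And>x. x \<in> V \<Longrightarrow> h (g x) = x" "\<And>x. x \<in> V \<Longrightarrow> g (h x) = x"
proof
  let ?h = "restrict (inv_into V g) V"
  have bij: "bij_betw g V V"
    using G_bij assms by blast
  show r: "g (?h x) = x" if "x \<in> V" for x
    using bij that by (simp add: bij_betw_inv_into_right)
  show "?h (g x) = x" if "x \<in> V" for x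
    using bij that assms by (simp add: bij_betw_inv_into_left)
  show "?h \<in> G"
  proof (rule G_I)
    show *: "inv_into V g x \<in> V" if "x \<in> V" for x
      using bij that by (metis bij_betw_def inv_into_into)
    show "inv_into V g x \<bullet> inv_into V g y = x \<bullet> y" if "x \<in> V" "y \<in> V" for x y
      using * r that assms by (metis G_dot restrict_apply')
  qed
qed

text \<open>The condition on \<open>M\<close> says that its columns are orthonormal. Hence pairing
  \<open>g x\<close> with column \<open>j\<close> returns \<open>x j\<close>, and expanding one
  factor of \<open>g x \<bullet> g y\<close> in the columns gives
  \<open>x \<bullet> y\<close>.\<close>

lemma orthogonal_matrix_in_G:
  assumes M: "orthogonal_matrix R d M"
  shows "(\<lambda>x\<in>V. \<lambda>i\<in>{..<d}. \<Oplus>j\<in>{..<d}. M i j \<otimes> x j) \<in> G"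
proof (rule G_I)
  define col where "col j = (\<lambda>i\<in>{..<d}. M i j)" for j
  define g where "g x = (\<lambda>i\<in>{..<d}. \<Oplus>j\<in>{..<d}. col j i \<otimes> x j)" for x
  have g_eq: "(\<lambda>i\<in>{..<d}. \<Oplus>j\<in>{..<d}. M i j \<otimes> x j) = g x" for x
    unfolding g_def col_def by (rule restrict_ext) simp
  have col: "col j \<in> V" if "j < d" for j
    using M that by (auto simp: col_def vectors_def orthogonal_matrix_def)
  have col_col: "col i \<bullet> col j = (if i = j then \<one> else \<zero>)" if "i < d" "j < d" for i j
  proof -
    have "col i \<bullet> col j = (\<Oplus>l\<in>{..<d}. M l i \<otimes> M l j)"
      unfolding dot_product_def col_def using M that
      by (intro finsum_cong') (auto simp: orthogonal_matrix_def)
    then show ?thesis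
      using M that by (auto simp: orthogonal_matrix_def)
  qed
  have gV: "g x \<in> V" if "x \<in> V" for x
    unfolding g_def using that col by (intro dot_finsum_left(2) [of _ _ _ zv]) auto
  have g_dot: "g x \<bullet> z = (\<Oplus>j\<in>{..<d}. x j \<otimes> (col j \<bullet> z))" if "x \<in> V" "z \<in> V" for x z
    unfolding g_def using that col by (intro dot_finsum_left(1)) auto
  have g_col: "g x \<bullet> col j = x j" if "x \<in> V" "j < d" for x j
  proof -
    have "g x \<bullet> col j = (\<Oplus>l\<in>{..<d}. if j = l then x l else \<zero>)"
      using that col by (subst g_dot) (auto simp: col_col intro!: finsum_cong')
    also have "\<dots> = x j"
      using that by (intro add.finprod_singleton) auto
    finally show ?thesis .
  qed
  show "(\<lambda>i\<in>{..<d}. \<Oplus>j\<in>{..<d}. M i j \<otimes> x j) \<in> V" if "x \<in> V" for x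
    using gV that by (simp add: g_eq del: restrict_apply)
  show "(\<lambda>i\<in>{..<d}. \<Oplus>j\<in>{..<d}. M i j \<otimes> x j) \<bullet> (\<lambda>i\<in>{..<d}. \<Oplus>j\<in>{..<d}. M i j \<otimes> y j) = x \<bullet> y"
    if xy: "x \<in> V" "y \<in> V" for x y
  proof -
    have "g x \<bullet> g y = (\<Oplus>j\<in>{..<d}. x j \<otimes> (col j \<bullet> g y))"
      using g_dot gV xy by blast
    also have "\<dots> = x \<bullet> y"
      unfolding dot_product_def [of R d x]
    proof (intro finsum_cong')
      fix j assume "j \<in> {..<d}"
      then show "x j \<otimes> (col j \<bullet> g y) = x j \<otimes> y j"
        using xy col gV by (simp add: dot_commute [of "col j"] g_col)
    qed (use xy in auto)
    finally show ?thesis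
      by (simp add: g_eq del: restrict_apply)
  qed
qed

text \<open>The columns of the matrix are the images of the unit vectors. That the matrix acts as
  \<open>g\<close> is checked by pairing with the vectors \<open>g z\<close>.\<close>

lemma G_orthogonal_matrix:
  assumes g: "g \<in> G"
  obtains M where "orthogonal_matrix R d M"
    "\<And>x. x \<in> V \<Longrightarrow> (\<lambda>i\<in>{..<d}. \<Oplus>j\<in>{..<d}. M i j \<otimes> x j) = g x"
proof
  let ?M = "\<lambda>i j. g (unit_vector j) i"
  have "(\<Oplus>l\<in>{..<d}. ?M l i \<otimes> ?M l j) = (if i = j then \<one> else \<zero>)" if "i < d" "j < d" for i j
  proof -
    have "g (unit_vector i) \<bullet> g (unit_vector j) = unit_vector i j"
      using g that by simp
    then show ?thesis
      using that by (auto simp: dot_product_def unit_vector_def)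
  qed
  then show "orthogonal_matrix R d ?M"
    using g by (auto simp: orthogonal_matrix_def)
  show "(\<lambda>i\<in>{..<d}. \<Oplus>j\<in>{..<d}. ?M i j \<otimes> x j) = g x" if x: "x \<in> V" for x
  proof (rule G_nondegenerate [OF g])
    show "(\<lambda>i\<in>{..<d}. \<Oplus>j\<in>{..<d}. ?M i j \<otimes> x j) \<in> V"
      using x g by (intro dot_finsum_left(2) [of _ _ _ zv]) auto
    fix z assume z: "z \<in> V"
    have "(\<lambda>i\<in>{..<d}. \<Oplus>j\<in>{..<d}. ?M i j \<otimes> x j) \<bullet> g z =
        (\<Oplus>j\<in>{..<d}. x j \<otimes> (g (unit_vector j) \<bullet> g z))"
      using x z g by (intro dot_finsum_left(1)) auto
    also have "\<dots> = x \<bullet> z"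
      unfolding dot_product_def [of R d x] using x z g
      by (intro finsum_cong') (auto simp: dot_commute [of "unit_vector _"])
    finally show "(\<lambda>i\<in>{..<d}. \<Oplus>j\<in>{..<d}. ?M i j \<otimes> x j) \<bullet> g z = g x \<bullet> g z"
      using x z g by simp
  qed (use x g in auto)
qed

text \<open>A matrix is constrained only in its first \<open>d\<close> rows and columns, so many
  functions \<open>M\<close> define the same motion. Elements of \<open>G\<close> are extensional
  and can be counted, which is why all later arguments use them.\<close>

lemma congruent_simplices_iff:
  assumes x: "\<And>i. i \<le> k \<Longrightarrow> x i \<in> V"
  shows "congruent_simplices R d k x y \<longleftrightarrow> (\<exists>g\<in>G. \<exists>b\<in>V. \<forall>i\<le>k. vadd (g (x i)) b = y i)"
proof
  assume "congruent_simplices R d k x y"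
  then obtain M b where M: "orthogonal_matrix R d M" "b \<in> V" "\<And>i. i \<le> k \<Longrightarrow> affine_map R d M b (x i) = y i"
    unfolding congruent_simplices_def by auto
  let ?g = "\<lambda>x\<in>V. \<lambda>i\<in>{..<d}. \<Oplus>j\<in>{..<d}. M i j \<otimes> x j"
  have "vadd (?g (x i)) b = y i" if "i \<le> k" for i
    unfolding M(3) [OF that, symmetric] using x [OF that]
    by (auto simp: vadd_def affine_map_def intro: restrict_ext)
  then show "\<exists>g\<in>G. \<exists>b\<in>V. \<forall>i\<le>k. vadd (g (x i)) b = y i"
    using orthogonal_matrix_in_G [OF M(1)] M(2) by blast
next
  assume "\<exists>g\<in>G. \<exists>b\<in>V. \<forall>i\<le>k. vadd (g (x i)) b = y i"
  then obtain g b where gb: "g \<in> G" "b \<in> V" "\<And>i. i \<le> k \<Longrightarrow> vadd (g (x i)) b = y i"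
    by auto
  obtain M where M: "orthogonal_matrix R d M"
    "\<And>x. x \<in> V \<Longrightarrow> (\<lambda>i\<in>{..<d}. \<Oplus>j\<in>{..<d}. M i j \<otimes> x j) = g x"
    using G_orthogonal_matrix [OF gb(1)] by blast
  have "affine_map R d M b (x i) = y i" if "i \<le> k" for i
    unfolding gb(3) [OF that, symmetric] M(2) [OF x [OF that], symmetric]
    by (auto simp: vadd_def affine_map_def intro: restrict_ext)
  then show "congruent_simplices R d k x y"
    unfolding congruent_simplices_def using M(1) gb(2) by blast
qed

section \<open>Pointwise stabilizers\<close>

definition fixer :: "(nat \<Rightarrow> 'a) set \<Rightarrow> ((nat \<Rightarrow> 'a) \<Rightarrow> nat \<Rightarrow> 'a) set" where
  "fixer X = {g \<in> G. \<forall>x\<in>X. g x = x}"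

text \<open>The orthogonal complement may meet the span of \<open>X\<close>, because nonzero
  isotropic vectors can occur. Only its cardinality is used, as a substitute for the rank of
  \<open>X\<close>.\<close>

definition perp :: "(nat \<Rightarrow> 'a) set \<Rightarrow> (nat \<Rightarrow> 'a) set" where
  "perp X = {w \<in> V. \<forall>x\<in>X. w \<bullet> x = \<zero>}"

lemma finite_fixer [simp]: "finite (fixer X)" and finite_perp [simp]: "finite (perp X)"
  by (auto simp: fixer_def perp_def)

lemma perp_V: "w \<in> perp X \<Longrightarrow> w \<in> V"
  by (simp add: perp_def)

lemma perp_add_smul:
  "X \<subseteq> V \<Longrightarrow> w \<in> perp X \<Longrightarrow> v \<in> perp X \<Longrightarrow> t \<in> carrier R \<Longrightarrow> vadd w (smul t v) \<in> perp X"
  by (auto simp: perp_def subset_iff dot_add_left dot_smul_left)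

lemma perp_insert: "w \<in> perp (insert x X) \<longleftrightarrow> w \<in> perp X \<and> w \<bullet> x = \<zero>"
  by (auto simp: perp_def)

lemma perp_smul: "X \<subseteq> V \<Longrightarrow> w \<in> perp X \<Longrightarrow> t \<in> carrier R \<Longrightarrow> smul t w \<in> perp X"
  by (auto simp: perp_def subset_iff dot_smul_left)

lemma vadd_smul_cancel:
  assumes "w \<in> V" "u \<in> V" "t \<in> carrier R"
  shows "vadd (vadd w (smul (\<ominus> t) u)) (smul t u) = w"
    "vadd (vadd w (smul t u)) (smul (\<ominus> t) u) = w"
  using assms by (auto intro!: vector_eqI simp: a_assoc l_minus l_neg r_neg)

lemma q_pos: "order R > 0"
  using finite_carrier by (auto simp: order_def card_gt_0_iff)

text \<open>Dimension counting is avoided: \<open>g\<close> moves every vector by an element of \<open>perp X\<close>.\<close>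

lemma fixer_fixes_double_perp:
  assumes X: "X \<subseteq> V" and x: "x \<in> V" and perp: "\<And>w. w \<in> perp X \<Longrightarrow> w \<bullet> x = \<zero>"
    and g: "g \<in> fixer X"
  shows "g x = x"
proof (rule dot_nondegenerate)
  have gG: "g \<in> G"
    using g by (simp add: fixer_def)
  show "g x \<in> V" "x \<in> V"
    using gG x by auto
  fix v assume v: "v \<in> V"
  obtain u where u: "u \<in> V" "g u = v"
    using G_surj gG v by blast
  \<comment> \<open>As \<open>v = g u\<close> and \<open>g\<close> fixes \<open>X\<close> pointwise,
    \<open>u\<close> and \<open>v\<close> have the same dot products with \<open>X\<close>. The
    assumption on \<open>x\<close> then extends this to \<open>x\<close>, and \<open>g x \<bullet> v
    = g x \<bullet> g u = x \<bullet> u = x \<bullet> v\<close>.\<close>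
  have "u \<bullet> y = v \<bullet> y" if "y \<in> X" for y
    using g u gG X that G_dot [of g u y] by (auto simp: fixer_def)
  then have "vsub u v \<in> perp X"
    using u v X by (auto simp: perp_def subset_iff dot_sub_left minus_eq r_neg)
  from perp [OF this] have "u \<bullet> x \<ominus> v \<bullet> x = \<zero>"
    using u v x by (simp add: dot_sub_left)
  then have "u \<bullet> x = v \<bullet> x"
    using u v x by (metis dot_closed r_right_minus_eq)
  then show "g x \<bullet> v = x \<bullet> v"
    using u v x gG by (metis G_dot dot_commute)
qed

text \<open>Pairing with \<open>x\<close> is a linear functional on \<open>perp X\<close> that does
  not vanish at \<open>v\<close>; its kernel is \<open>perp (insert x X)\<close> and each of its
  \<open>order R\<close> fibres is a translate of the kernel. Rescaling \<open>v\<close> to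
  \<open>u\<close> with \<open>u \<bullet> x = \<one>\<close> makes the splitting explicit.\<close>

lemma card_perp_insert:
  assumes X: "X \<subseteq> V" and x: "x \<in> V" and v: "v \<in> perp X" "v \<bullet> x \<noteq> \<zero>"
  shows "card (perp X) = order R * card (perp (insert x X))"
proof -
  define u where "u = smul (inv (v \<bullet> x)) v"
  have inv: "v \<bullet> x \<in> Units R"
    using v x by (simp add: field_Units perp_V)
  then have c: "inv (v \<bullet> x) \<in> carrier R" "inv (v \<bullet> x) \<otimes> (v \<bullet> x) = \<one>"
    by (rule Units_inv_closed, rule Units_l_inv)
  have u: "u \<in> perp X" "u \<bullet> x = \<one>"
    unfolding u_def using perp_smul [OF X v(1) c(1)] c perp_V [OF v(1)] x by (simp_all add: dot_smul_left)
  have "bij_betw (\<lambda>(t, w). vadd w (smul t u)) (carrier R \<times> perp (insert x X)) (perp X)"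
  proof (rule bij_betw_byWitness [where f' = "\<lambda>w. (w \<bullet> x, vadd w (smul (\<ominus> (w \<bullet> x)) u))"])
    have uV: "u \<in> V"
      using u(1) by (rule perp_V)
    have dot: "vadd w (smul t u) \<bullet> x = w \<bullet> x \<oplus> t" if "w \<in> V" "t \<in> carrier R" for w t
      using u(2) uV x that by (simp add: dot_add_left dot_smul_left)
    show "\<forall>a\<in>carrier R \<times> perp (insert x X).
        ((case a of (t, w) \<Rightarrow> vadd w (smul t u)) \<bullet> x,
         vadd (case a of (t, w) \<Rightarrow> vadd w (smul t u))
          (smul (\<ominus> ((case a of (t, w) \<Rightarrow> vadd w (smul t u)) \<bullet> x)) u)) = a"
    proof
      fix a assume "a \<in> carrier R \<times> perp (insert x X)"
      then obtain t w where a: "a = (t, w)" "t \<in> carrier R" "w \<in> perp (insert x X)"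
        by blast
      moreover from a(3) have "w \<in> V" "w \<bullet> x = \<zero>"
        by (auto simp: perp_insert perp_V)
      ultimately show "((case a of (t, w) \<Rightarrow> vadd w (smul t u)) \<bullet> x,
         vadd (case a of (t, w) \<Rightarrow> vadd w (smul t u))
          (smul (\<ominus> ((case a of (t, w) \<Rightarrow> vadd w (smul t u)) \<bullet> x)) u)) = a"
        using uV by (simp add: dot vadd_smul_cancel)
    qed
    show "\<forall>a'\<in>perp X. (case (a' \<bullet> x, vadd a' (smul (\<ominus> (a' \<bullet> x)) u)) of
        (t, w) \<Rightarrow> vadd w (smul t u)) = a'"
      using x uV by (simp add: perp_V vadd_smul_cancel)
    show "(\<lambda>(t, w). vadd w (smul t u)) ` (carrier R \<times> perp (insert x X)) \<subseteq> perp X"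
      using perp_add_smul [OF X _ u(1)] by (simp add: image_subset_iff perp_insert)
    show "(\<lambda>w. (w \<bullet> x, vadd w (smul (\<ominus> (w \<bullet> x)) u))) ` perp X \<subseteq> carrier R \<times> perp (insert x X)"
    proof (rule image_subsetI)
      fix w assume w: "w \<in> perp X"
      then show "(w \<bullet> x, vadd w (smul (\<ominus> (w \<bullet> x)) u)) \<in> carrier R \<times> perp (insert x X)"
        using perp_add_smul [OF X w u(1)] x perp_V [OF w] by (simp add: perp_insert dot r_neg)
    qed
  qed
  from bij_betw_same_card [OF this] show ?thesis
    by (simp add: card_cartesian_product order_def)
qed

section \<open>Counting points on quadrics over a field of odd order\<close>

lemma double_eq_zero:
  assumes "odd (order R)" "a \<in> carrier R" "a \<oplus> a = \<zero>" shows "a = \<zero>"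
proof -
  obtain m where m: "order R = 2 * m + 1"
    using assms(1) by (elim oddE)
  have "[order (add_monoid R)] \<cdot> a = \<zero>"
    using assms(2) by (intro add.pow_order_eq_1) simp
  then have "[(2 * m + 1)] \<cdot> a = \<zero>"
    using m by (simp add: order_def)
  \<comment> \<open>The additive group has order \<open>2 * m + 1\<close>, which annihilates
    \<open>a\<close>; if twice \<open>a\<close> vanishes as well, only \<open>a\<close> itself
    remains.\<close>
  moreover have "[(2 * m + 1)] \<cdot> a = [m] \<cdot> ([(2::nat)] \<cdot> a) \<oplus> a"
    using assms(2) by (simp add: add.nat_pow_mult add.nat_pow_pow mult.commute)
  moreover have "[(2::nat)] \<cdot> a = \<zero>"
    using assms(2,3) by (simp add: numeral_2_eq_2)
  ultimately show ?thesis
    using assms(2) by simp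
qed

text \<open>Subtracting the equations of two distinct roots \<open>u\<close> and \<open>t\<close>
  and cancelling \<open>u \<ominus> t\<close> leaves Vieta's formula for
  \<open>u \<oplus> t\<close>. One root thus determines the only other candidate.\<close>

lemma card_quadratic_roots:
  assumes "a \<in> carrier R" "b \<in> carrier R" "c \<in> carrier R" "c \<noteq> \<zero>"
  shows "card {t \<in> carrier R. a \<oplus> t \<otimes> b \<oplus> t \<otimes> t \<otimes> c = \<zero>} \<le> 2" (is "card ?S \<le> 2")
proof (cases "?S = {}")
  case False
  then obtain t where t: "t \<in> carrier R" "a \<oplus> t \<otimes> b \<oplus> t \<otimes> t \<otimes> c = \<zero>"
    by auto
  have "u = \<ominus> (b \<otimes> inv c) \<ominus> t" if u: "u \<in> carrier R" "a \<oplus> u \<otimes> b \<oplus> u \<otimes> u \<otimes> c = \<zero>" "u \<noteq> t" for u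
  proof -
    have "(u \<ominus> t) \<otimes> (b \<oplus> (u \<oplus> t) \<otimes> c) =
        (a \<oplus> u \<otimes> b \<oplus> u \<otimes> u \<otimes> c) \<ominus> (a \<oplus> t \<otimes> b \<oplus> t \<otimes> t \<otimes> c)"
      using t(1) u(1) assms(1-3) by algebra
    then have "(u \<ominus> t) \<otimes> (b \<oplus> (u \<oplus> t) \<otimes> c) = \<zero>"
      using t u by (simp add: minus_eq)
    moreover have "u \<ominus> t \<noteq> \<zero>"
      using t u by simp
    ultimately have e: "b \<oplus> (u \<oplus> t) \<otimes> c = \<zero>"
      using t u assms by (metis a_closed m_closed minus_closed integral)
    have i: "inv c \<in> carrier R" "c \<otimes> inv c = \<one>"
      using assms by (auto simp: field_Units)
    have "(b \<oplus> (u \<oplus> t) \<otimes> c) \<otimes> inv c = b \<otimes> inv c \<oplus> (u \<oplus> t) \<otimes> (c \<otimes> inv c)"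
      using t(1) u(1) assms(1-3) i(1) by algebra
    then have "b \<otimes> inv c \<oplus> (u \<oplus> t) = \<zero>"
      using e i t u by simp
    moreover have "u = (b \<otimes> inv c \<oplus> (u \<oplus> t)) \<oplus> (\<ominus> (b \<otimes> inv c) \<ominus> t)"
      using t(1) u(1) assms(1-3) i(1) by algebra
    ultimately show ?thesis
      using t assms i(1) by simp
  qed
  then have "?S \<subseteq> {t, \<ominus> (b \<otimes> inv c) \<ominus> t}"
    by auto
  then have "card ?S \<le> card {t, \<ominus> (b \<otimes> inv c) \<ominus> t}"
    by (intro card_mono) auto
  also have "\<dots> \<le> 2"
    by (simp add: card_insert_if)
  finally show ?thesis .
next
  case True
  then show ?thesis by (metis card.empty zero_le)
qed

lemma bij_perp_translate:
  assumes "X \<subseteq> V" "v \<in> perp X" "t \<in> carrier R"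
  shows "bij_betw (\<lambda>w. vadd w (smul t v)) (perp X) (perp X)"
proof (rule bij_betw_byWitness [where f' = "\<lambda>w. vadd w (smul (\<ominus> t) v)"])
  show "\<forall>w\<in>perp X. vadd (vadd w (smul t v)) (smul (\<ominus> t) v) = w"
    "\<forall>w\<in>perp X. vadd (vadd w (smul (\<ominus> t) v)) (smul t v) = w"
    using assms by (simp_all add: perp_V vadd_smul_cancel)
  show "(\<lambda>w. vadd w (smul t v)) ` perp X \<subseteq> perp X"
    "(\<lambda>w. vadd w (smul (\<ominus> t) v)) ` perp X \<subseteq> perp X"
    using perp_add_smul [OF assms(1) _ assms(2)] assms(3) by blast+
qed

text \<open>If every vector of \<open>perp X\<close> is isotropic, the equation reduces to twice
  \<open>w \<bullet> x\<close> being zero, which in odd order describes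
  \<open>perp (insert x X)\<close>. Otherwise some \<open>u\<close> in \<open>perp X\<close> is
  anisotropic, and each line in direction \<open>u\<close> meets the quadric in at most two points,
  because the equation restricted to it has leading coefficient
  \<open>u \<bullet> u\<close>.\<close>

lemma card_quadric_perp:
  assumes odd: "odd (order R)" and X: "X \<subseteq> V" and x: "x \<in> V" and v: "v \<in> perp X" "v \<bullet> x \<noteq> \<zero>"
  shows "order R * card {w \<in> perp X. w \<bullet> w \<oplus> (w \<bullet> x \<oplus> w \<bullet> x) = \<zero>} \<le> 2 * card (perp X)"
    (is "_ * card ?S \<le> _")
proof (cases "\<exists>u\<in>perp X. u \<bullet> u \<noteq> \<zero>")
  case False
  have "?S \<subseteq> perp (insert x X)"
  proof
    fix w assume w: "w \<in> ?S"
    then have "w \<in> V" "w \<bullet> w = \<zero>"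
      using False by (auto simp: perp_V)
    then have "w \<bullet> x = \<zero>"
      using w odd x double_eq_zero [of "w \<bullet> x"] by simp
    with w show "w \<in> perp (insert x X)"
      by (simp add: perp_insert)
  qed
  then have "order R * card ?S \<le> order R * card (perp (insert x X))"
    by (intro mult_left_mono card_mono) auto
  also have "\<dots> = card (perp X)"
    using card_perp_insert [OF X x v] by simp
  finally show ?thesis by simp
next
  case True
  then obtain u where u: "u \<in> perp X" "u \<bullet> u \<noteq> \<zero>"
    by blast
  \<comment> \<open>Double counting of the pairs \<open>(t, w)\<close> for which \<open>w\<close>
    moved by \<open>t\<close> times \<open>u\<close> lies on the quadric: for fixed \<open>t\<close>
    translation is a bijection of \<open>perp X\<close>, for fixed \<open>w\<close> the points form
    a line.\<close>
  have "order R * card ?S = (\<Sum>t\<in>carrier R. card {w \<in> perp X. vadd w (smul t u) \<in> ?S})"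
  proof -
    have "card {w \<in> perp X. vadd w (smul t u) \<in> ?S} = card ?S" if "t \<in> carrier R" for t
    proof -
      have "bij_betw (\<lambda>w. vadd w (smul t u)) {w \<in> perp X. vadd w (smul t u) \<in> ?S} ?S"
      proof (rule bij_betw_subset [OF bij_perp_translate [OF X u(1) that]])
        have "w \<in> (\<lambda>w. vadd w (smul t u)) ` perp X" if "w \<in> ?S" for w
          using bij_perp_translate [OF X u(1) \<open>t \<in> carrier R\<close>] that by (auto simp: bij_betw_def)
        then show "(\<lambda>w. vadd w (smul t u)) ` {w \<in> perp X. vadd w (smul t u) \<in> ?S} = ?S"
          by blast
      qed blast
      then show ?thesis
        by (rule bij_betw_same_card)
    qed
    then show ?thesis
      by (simp add: order_def)
  qed
  also have "\<dots> = (\<Sum>w\<in>perp X. card {t \<in> carrier R. vadd w (smul t u) \<in> ?S})"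
    using sum.swap_restrict [OF finite_carrier finite_perp [of X],
        where g = "\<lambda>_ _. 1::nat" and R = "\<lambda>t w. vadd w (smul t u) \<in> ?S"] finite_carrier
    by simp
  also have "\<dots> \<le> (\<Sum>w\<in>perp X. 2)"
  proof (rule sum_mono)
    fix w assume w: "w \<in> perp X"
    have "{t \<in> carrier R. vadd w (smul t u) \<in> ?S} \<subseteq> {t \<in> carrier R. (w \<bullet> w \<oplus> (w \<bullet> x \<oplus> w \<bullet> x)) \<oplus>
        t \<otimes> (w \<bullet> u \<oplus> w \<bullet> u \<oplus> (u \<bullet> x \<oplus> u \<bullet> x)) \<oplus> t \<otimes> t \<otimes> (u \<bullet> u) = \<zero>}" (is "_ \<subseteq> ?Q")
    proof clarify
      fix t assume t: "t \<in> carrier R"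
        and z: "vadd w (smul t u) \<bullet> vadd w (smul t u) \<oplus>
          (vadd w (smul t u) \<bullet> x \<oplus> vadd w (smul t u) \<bullet> x) = \<zero>"
      have [simp]: "w \<in> V" "u \<in> V" and uw: "u \<bullet> w = w \<bullet> u"
        using w u by (auto simp: perp_V intro: dot_commute)
      have car: "w \<bullet> w \<in> carrier R" "w \<bullet> u \<in> carrier R" "u \<bullet> u \<in> carrier R" "w \<bullet> x \<in> carrier R"
        "u \<bullet> x \<in> carrier R"
        using x by auto
      have "(w \<bullet> w \<oplus> (w \<bullet> x \<oplus> w \<bullet> x)) \<oplus>
        t \<otimes> (w \<bullet> u \<oplus> w \<bullet> u \<oplus> (u \<bullet> x \<oplus> u \<bullet> x)) \<oplus> t \<otimes> t \<otimes> (u \<bullet> u) =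
        w \<bullet> w \<oplus> t \<otimes> (w \<bullet> u) \<oplus> (t \<otimes> (w \<bullet> u) \<oplus> t \<otimes> (t \<otimes> (u \<bullet> u))) \<oplus>
        ((w \<bullet> x \<oplus> t \<otimes> (u \<bullet> x)) \<oplus> (w \<bullet> x \<oplus> t \<otimes> (u \<bullet> x)))"
        using car t by algebra
      also have "\<dots> = \<zero>"
        using z t x by (simp add: dot_add_left dot_add_right dot_smul_left dot_smul_right uw
            a_ac r_distr)
      finally show "(w \<bullet> w \<oplus> (w \<bullet> x \<oplus> w \<bullet> x)) \<oplus>
        t \<otimes> (w \<bullet> u \<oplus> w \<bullet> u \<oplus> (u \<bullet> x \<oplus> u \<bullet> x)) \<oplus> t \<otimes> t \<otimes> (u \<bullet> u) = \<zero>" .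
    qed
    then have "card {t \<in> carrier R. vadd w (smul t u) \<in> ?S} \<le> card ?Q"
      using finite_carrier by (intro card_mono) auto
    also have "\<dots> \<le> 2"
      using w u x by (intro card_quadratic_roots) (simp_all add: perp_V)
    finally show "card {t \<in> carrier R. vadd w (smul t u) \<in> ?S} \<le> 2" .
  qed
  finally show ?thesis by simp
qed

text \<open>An isometry that fixes \<open>X\<close> displaces \<open>x\<close> by some
  \<open>w\<close> in \<open>perp X\<close>. Expanding the equality of \<open>x \<bullet> x\<close>
  and \<open>g x \<bullet> g x\<close> with \<open>g x = vadd w x\<close> puts \<open>w\<close> on
  the quadric counted before.\<close>

lemma card_fixer_orbit:
  assumes odd: "odd (order R)" and X: "X \<subseteq> V" and x: "x \<in> V" and v: "v \<in> perp X" "v \<bullet> x \<noteq> \<zero>"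
  shows "order R * card ((\<lambda>g. g x) ` fixer X) \<le> 2 * card (perp X)"
proof -
  let ?S = "{w \<in> perp X. w \<bullet> w \<oplus> (w \<bullet> x \<oplus> w \<bullet> x) = \<zero>}"
  have "(\<lambda>y. vsub y x) ` (\<lambda>g. g x) ` fixer X \<subseteq> ?S"
  proof clarify
    fix g assume g: "g \<in> fixer X"
    then have gG: "g \<in> G"
      by (simp add: fixer_def)
    let ?w = "vsub (g x) x"
    have w: "?w \<in> V"
      using gG x by auto
    have "?w \<bullet> y = \<zero>" if "y \<in> X" for y
    proof -
      have "y \<in> V" "g y = y"
        using g X that by (auto simp: fixer_def)
      then have "g x \<bullet> y = x \<bullet> y"
        using G_dot [OF gG x, of y] by simp
      then show ?thesis
        using gG x \<open>y \<in> V\<close> by (simp add: dot_sub_left minus_eq r_neg)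
    qed
    with w have "?w \<in> perp X"
      by (simp add: perp_def)
    moreover have "?w \<bullet> ?w \<oplus> (?w \<bullet> x \<oplus> ?w \<bullet> x) = \<zero>"
    proof -
      have "x \<bullet> x = vadd ?w x \<bullet> vadd ?w x"
        using gG x by simp
      also have "\<dots> = ?w \<bullet> ?w \<oplus> (?w \<bullet> x \<oplus> ?w \<bullet> x) \<oplus> x \<bullet> x"
        using w x by (simp add: dot_add_left dot_add_right dot_commute [of x ?w] a_ac del: vadd_vsub)
      finally show ?thesis
        using w x add.l_cancel_one [of "x \<bullet> x" "?w \<bullet> ?w \<oplus> (?w \<bullet> x \<oplus> ?w \<bullet> x)"] by (simp add: a_comm)
    qed
    ultimately show "?w \<in> perp X \<and> ?w \<bullet> ?w \<oplus> (?w \<bullet> x \<oplus> ?w \<bullet> x) = \<zero>"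
      by blast
  qed
  moreover have "inj_on (\<lambda>y. vsub y x) ((\<lambda>g. g x) ` fixer X)"
    by (rule inj_on_inverseI [where g = "\<lambda>w. vadd w x"]) (use x in \<open>auto simp: fixer_def\<close>)
  ultimately have "card ((\<lambda>g. g x) ` fixer X) \<le> card ?S"
    by (intro card_inj_on_le) auto
  then show ?thesis
    using card_quadric_perp [OF assms] by (meson mult_le_mono2 order_trans)
qed

text \<open>The inequality needed from the orbit-stabilizer theorem: composing with the inverse of
  one member of a fibre of \<open>g \<mapsto> g x\<close> embeds that fibre in the stabilizer of
  \<open>insert x X\<close>.\<close>

lemma card_fixer_le:
  assumes X: "X \<subseteq> V" and x: "x \<in> V"
  shows "card (fixer X) \<le> card ((\<lambda>g. g x) ` fixer X) * card (fixer (insert x X))"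
proof -
  have "card (fixer X) = (\<Sum>y\<in>(\<lambda>g. g x) ` fixer X. card {g \<in> fixer X. g x = y})"
    by (rule sum.image_gen [of _ "\<lambda>_. 1::nat", simplified]) auto
  also have "\<dots> \<le> (\<Sum>y\<in>(\<lambda>g. g x) ` fixer X. card (fixer (insert x X)))"
  proof (rule sum_mono)
    fix y assume "y \<in> (\<lambda>g. g x) ` fixer X"
    then obtain g where g: "g \<in> fixer X" "g x = y"
      by auto
    then have gG: "g \<in> G"
      by (simp add: fixer_def)
    obtain h where h: "h \<in> G" "\<And>x. x \<in> V \<Longrightarrow> h (g x) = x" "\<And>x. x \<in> V \<Longrightarrow> g (h x) = x"
      using G_inverse [OF gG] by blast
    show "card {g \<in> fixer X. g x = y} \<le> card (fixer (insert x X))"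
    proof (rule card_inj_on_le [where f = "compose V h"])
      show "inj_on (compose V h) {g \<in> fixer X. g x = y}"
      proof (rule inj_onI)
        fix a b assume ab: "a \<in> {g \<in> fixer X. g x = y}" "b \<in> {g \<in> fixer X. g x = y}"
          "compose V h a = compose V h b"
        have abG: "a \<in> G" "b \<in> G"
          using ab by (auto simp: fixer_def)
        then show "a = b"
        proof (rule G_eqI)
          fix z assume z: "z \<in> V"
          then have "h (a z) = h (b z)"
            using fun_cong [OF ab(3), of z] by (simp add: compose_def)
          then show "a z = b z"
            using h(3) abG z by (metis G_closed)
        qed
      qed
      show "compose V h ` {g \<in> fixer X. g x = y} \<subseteq> fixer (insert x X)"
      proof clarify
        fix a assume a: "a \<in> fixer X" "y = a x"
        then have "a \<in> G"
          by (simp add: fixer_def)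
        moreover have "h (a z) = z" if "z \<in> insert x X" for z
        proof (cases "z = x")
          case True
          then show ?thesis using a g h(2) x by metis
        next
          case False
          then have "z \<in> X" using that by simp
          then show ?thesis
            using a g h(2) [of z] X by (auto simp: fixer_def)
        qed
        ultimately show "compose V h a \<in> fixer (insert x X)"
          using h(1) X x G_compose [of h a] by (auto simp: fixer_def compose_eq subset_iff)
      qed
    qed auto
  qed
  finally show ?thesis by simp
qed

text \<open>The number \<open>r\<close> is the rank of \<open>X\<close>. A new vector orthogonal to
  \<open>perp X\<close> changes neither \<open>perp X\<close> nor the stabilizer. Any other new
  vector divides the size of \<open>perp X\<close> by \<open>order R\<close> and costs at most its
  orbit size, \<open>2 * order R ^ (d - 1 - r)\<close>.\<close>

lemma card_G_le_fixer_aux: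
  assumes odd: "odd (order R)" and "finite X" "X \<subseteq> V"
  shows "\<exists>r\<le>card X. r \<le> d \<and> card (perp X) = order R ^ (d - r) \<and>
    card G \<le> card (fixer X) * 2 ^ r * order R ^ (\<Sum>j<r. d - 1 - j)"
  using assms(2,3)
proof (induction X)
  case empty
  have "perp {} = V" "fixer {} = G"
    by (auto simp: perp_def fixer_def)
  then show ?case
    by (intro exI [of _ 0]) (simp add: card_V)
next
  case (insert x X)
  then have x: "x \<in> V" and X: "X \<subseteq> V"
    by auto
  from insert obtain r where r: "r \<le> card X" "r \<le> d" "card (perp X) = order R ^ (d - r)"
    "card G \<le> card (fixer X) * 2 ^ r * order R ^ (\<Sum>j<r. d - 1 - j)"
    by auto
  show ?case
  proof (cases "\<exists>v\<in>perp X. v \<bullet> x \<noteq> \<zero>")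
    case False
    then have "perp (insert x X) = perp X"
      by (auto simp: perp_def)
    moreover have "fixer (insert x X) = fixer X"
      using False fixer_fixes_double_perp [OF X x] by (auto simp: fixer_def)
    ultimately show ?thesis
      using r insert.hyps by (intro exI [of _ r]) auto
  next
    case True
    then obtain v where v: "v \<in> perp X" "v \<bullet> x \<noteq> \<zero>"
      by blast
    have q: "order R * card (perp (insert x X)) = order R ^ (d - r)"
      using card_perp_insert [OF X x v] r by simp
    \<comment> \<open>Guards against truncation in \<open>d - 1 - r\<close>: at \<open>r = d\<close>
      the equation \<open>q\<close> would force a field with one element.\<close>
    have "r \<noteq> d"
    proof
      assume "r = d"
      then have "order R = 1"
        using q by simp
      then have "card (carrier R) = 1"
        by (simp add: order_def)
      then show False
        using one_not_zero zero_closed one_closed by (metis card_1_singletonE singletonD)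
    qed
    then have rd: "r < d" "d - r = Suc (d - 1 - r)"
      using r by auto
    have "order R * card ((\<lambda>g. g x) ` fixer X) \<le> order R * (2 * order R ^ (d - 1 - r))"
      using card_fixer_orbit [OF odd X x v] r(3) rd(2) by simp
    then have orb: "card ((\<lambda>g. g x) ` fixer X) \<le> 2 * order R ^ (d - 1 - r)"
      using q_pos by simp
    have "card G \<le> card (fixer X) * (2 ^ r * order R ^ (\<Sum>j<r. d - 1 - j))"
      using r(4) by (simp add: mult.assoc)
    also have "\<dots> \<le> (2 * order R ^ (d - 1 - r) * card (fixer (insert x X))) * (2 ^ r * order R ^ (\<Sum>j<r. d - 1 - j))"
      using card_fixer_le [OF X x] orb by (meson mult_le_mono1 order_trans)
    also have "\<dots> = card (fixer (insert x X)) * 2 ^ Suc r * order R ^ (\<Sum>j<Suc r. d - 1 - j)"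
      by (simp add: power_add)
    finally have "card G \<le> card (fixer (insert x X)) * 2 ^ Suc r * order R ^ (\<Sum>j<Suc r. d - 1 - j)" .
    moreover have "card (perp (insert x X)) = order R ^ (d - Suc r)"
      using q rd q_pos by simp
    ultimately show ?thesis
      using r rd insert.hyps by (intro exI [of _ "Suc r"]) auto
  qed
qed

lemma sum_codimensions: "k \<le> d \<Longrightarrow> (\<Sum>j<k. d - 1 - j) = k * d - ((k + 1) choose 2)"
  and choose_le_mult: "k \<le> d \<Longrightarrow> ((k + 1) choose 2) \<le> k * d"
proof -
  \<comment> \<open>The additive form avoids truncated subtraction and yields both claims at
    once.\<close>
  have *: "(\<Sum>j<k. d - 1 - j) + ((k + 1) choose 2) = k * d" if "k \<le> d"
    using that
  proof (induction k)
    case (Suc k)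
    then show ?case by (simp add: numeral_2_eq_2)
  qed simp
  show "k \<le> d \<Longrightarrow> (\<Sum>j<k. d - 1 - j) = k * d - ((k + 1) choose 2)"
    "k \<le> d \<Longrightarrow> ((k + 1) choose 2) \<le> k * d"
    using * by (auto simp flip: *)
qed

text \<open>A degenerate simplex has rank below \<open>k\<close>. Enlarging the bound to rank
  \<open>k\<close> makes it the same for all simplices.\<close>

lemma card_G_le_fixer:
  assumes odd: "odd (order R)" and "finite X" "X \<subseteq> V" "card X \<le> k" "k \<le> d"
  shows "card G \<le> card (fixer X) * (2 ^ k * order R ^ (k * d - ((k + 1) choose 2)))"
proof -
  obtain r where r: "r \<le> card X" 
    "card G \<le> card (fixer X) * 2 ^ r * order R ^ (\<Sum>j<r. d - 1 - j)"
    using card_G_le_fixer_aux [OF assms(1-3)] by blast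
  have "(\<Sum>j<r. d - 1 - j) \<le> (\<Sum>j<k. d - 1 - j)"
    using r(1) assms by (intro sum_mono2) auto
  then have "2 ^ r * order R ^ (\<Sum>j<r. d - 1 - j) \<le> 2 ^ k * order R ^ (\<Sum>j<k. d - 1 - j)"
    using r(1) assms q_pos by (intro mult_mono power_increasing) auto
  then have "card (fixer X) * (2 ^ r * order R ^ (\<Sum>j<r. d - 1 - j)) \<le>
      card (fixer X) * (2 ^ k * order R ^ (\<Sum>j<k. d - 1 - j))"
    by (rule mult_le_mono2)
  then show ?thesis
    using r(2) by (simp only: mult.assoc sum_codimensions [OF assms(5)])
qed

end

section \<open>Fourier analysis\<close>

locale finite_field_character = finite_field_space +
  fixes \<chi> :: "'a \<Rightarrow> complex"
  assumes character: "nontrivial_additive_character R \<chi>"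
begin

lemma chi_norm [simp]: "a \<in> carrier R \<Longrightarrow> cmod (\<chi> a) = 1"
  and chi_add: "a \<in> carrier R \<Longrightarrow> b \<in> carrier R \<Longrightarrow> \<chi> (a \<oplus> b) = \<chi> a * \<chi> b"
  using character by (auto simp: nontrivial_additive_character_def)

lemma chi_zero [simp]: "\<chi> \<zero> = 1"
proof -
  have "\<chi> \<zero> * \<chi> \<zero> = \<chi> \<zero> * 1"
    using chi_add [of \<zero> \<zero>] by simp
  moreover have "\<chi> \<zero> \<noteq> 0"
    by (metis chi_norm norm_zero zero_closed zero_neq_one)
  ultimately show ?thesis
    by simp
qed

lemma chi_minus: 
  assumes a: "a \<in> carrier R" shows "\<chi> (\<ominus> a) = cnj (\<chi> a)"
proof -
  have "\<chi> a * \<chi> (\<ominus> a) = 1"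
    using a chi_add [of a "\<ominus> a"] by (simp add: r_neg)
  moreover have "\<chi> a * cnj (\<chi> a) = 1"
    using a by (simp add: complex_norm_square [symmetric])
  moreover have "\<chi> a \<noteq> 0"
    using a by (metis chi_norm norm_zero zero_neq_one)
  ultimately show ?thesis
    by (metis mult_cancel_left)
qed

text \<open>Orthogonality of characters. For nonzero \<open>y\<close> there is \<open>x0\<close> for
  which \<open>x0 \<bullet> y\<close> is a point \<open>a\<close> where \<open>\<chi>\<close>
  differs from 1; translation by \<open>x0\<close> preserves the sum but multiplies it by
  \<open>\<chi> a\<close>, so the sum vanishes.\<close>

lemma sum_chi_dot:
  assumes y: "y \<in> V"
  shows "(\<Sum>x\<in>V. \<chi> (x \<bullet> y)) = (if y = zv then of_nat (order R ^ d) else 0)"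
proof (cases "y = zv")
  case True
  then have "(\<Sum>x\<in>V. \<chi> (x \<bullet> y)) = (\<Sum>x\<in>V. 1)"
    by (intro sum.cong) auto
  then show ?thesis
    using True by (simp add: card_V)
next
  case False
  obtain j where j: "j < d" "y j \<noteq> \<zero>"
    using False y vector_eqI [of y zv] vec_closed(4) by auto
  obtain a where a: "a \<in> carrier R" "\<chi> a \<noteq> 1"
    using character by (auto simp: nontrivial_additive_character_def)
  have yj: "y j \<in> Units R"
    using j y by (simp add: field_Units vector_comp)
  define c where "c = a \<otimes> inv (y j)"
  have c: "c \<in> carrier R" "c \<otimes> y j = a"
    using a yj j y Units_inv_closed [OF yj] Units_l_inv [OF yj] 
    by (simp_all add: c_def m_assoc vector_comp)
  define x0 where "x0 = smul c (unit_vector j)"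
  have x0: "x0 \<in> V"
    using c by (simp add: x0_def vec_closed)
  have x0y: "x0 \<bullet> y = a"
    using c j y by (simp add: x0_def dot_smul_left vec_closed dot_commute [of "unit_vector j"])
  have "(\<Sum>x\<in>V. \<chi> (x \<bullet> y)) = (\<Sum>x\<in>V. \<chi> (vadd x x0 \<bullet> y))"
    by (rule sum.reindex_bij_betw [symmetric]) (rule bij_vadd [OF x0])
  also have "\<dots> = (\<Sum>x\<in>V. \<chi> (x \<bullet> y)) * \<chi> a"
    unfolding sum_distrib_right
    using x0 y by (intro sum.cong) (simp_all add: dot_add_left chi_add x0y [symmetric])
  finally show ?thesis
    using False a by simp
qed

lemma sum_chi_dot_diff:
  assumes "b \<in> V" "c \<in> V"
  shows "(\<Sum>x\<in>V. \<chi> (\<ominus> (x \<bullet> b)) * cnj (\<chi> (\<ominus> (x \<bullet> c)))) = (if b = c then of_nat (order R ^ d) else 0)"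
proof -
  have "(\<Sum>x\<in>V. \<chi> (\<ominus> (x \<bullet> b)) * cnj (\<chi> (\<ominus> (x \<bullet> c)))) = (\<Sum>x\<in>V. \<chi> (x \<bullet> vsub c b))"
  proof (rule sum.cong)
    fix x assume x: "x \<in> V"
    have "\<chi> (x \<bullet> vsub c b) = \<chi> (x \<bullet> c) * \<chi> (\<ominus> (x \<bullet> b))"
      using assms x by (simp add: dot_sub_right minus_eq chi_add)
    then show "\<chi> (\<ominus> (x \<bullet> b)) * cnj (\<chi> (\<ominus> (x \<bullet> c))) = \<chi> (x \<bullet> vsub c b)"
      using assms x by (simp add: chi_minus)
  qed simp
  also have "\<dots> = (if b = c then of_nat (order R ^ d) else 0)"
    using assms vsub_eq_zero_iff [OF assms(2,1)] by (subst sum_chi_dot) auto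
  finally show ?thesis .
qed

text \<open>Expand the square and sum over the frequency first; only the diagonal
  \<open>b = c\<close> survives. The transform is unnormalized, which accounts for the factor
  \<open>order R ^ d\<close>.\<close>

lemma plancherel:
  fixes f :: "(nat \<Rightarrow> 'a) \<Rightarrow> complex"
  shows "(\<Sum>x\<in>V. (cmod (\<Sum>b\<in>V. f b * \<chi> (\<ominus> (x \<bullet> b))))\<^sup>2) = real (order R) ^ d * (\<Sum>b\<in>V. (cmod (f b))\<^sup>2)"
proof -
  have "complex_of_real (\<Sum>x\<in>V. (cmod (\<Sum>b\<in>V. f b * \<chi> (\<ominus> (x \<bullet> b))))\<^sup>2) =
      (\<Sum>x\<in>V. (\<Sum>b\<in>V. f b * \<chi> (\<ominus> (x \<bullet> b))) * cnj (\<Sum>c\<in>V. f c * \<chi> (\<ominus> (x \<bullet> c))))"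
    unfolding of_real_sum complex_norm_square ..
  also have "\<dots> = (\<Sum>x\<in>V. \<Sum>b\<in>V. \<Sum>c\<in>V. f b * cnj (f c) * (\<chi> (\<ominus> (x \<bullet> b)) * cnj (\<chi> (\<ominus> (x \<bullet> c)))))"
    by (simp add: sum_product cnj_sum mult_ac)
  also have "\<dots> = (\<Sum>b\<in>V. \<Sum>x\<in>V. \<Sum>c\<in>V. f b * cnj (f c) * (\<chi> (\<ominus> (x \<bullet> b)) * cnj (\<chi> (\<ominus> (x \<bullet> c)))))"
    by (rule sum.swap)
  also have "\<dots> = (\<Sum>b\<in>V. \<Sum>c\<in>V. \<Sum>x\<in>V. f b * cnj (f c) * (\<chi> (\<ominus> (x \<bullet> b)) * cnj (\<chi> (\<ominus> (x \<bullet> c)))))"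
    by (rule sum.cong [OF refl], rule sum.swap)
  also have "\<dots> = (\<Sum>b\<in>V. \<Sum>c\<in>V. f b * cnj (f c) * (if b = c then of_nat (order R ^ d) else 0))"
    unfolding sum_distrib_left [symmetric] by (intro sum.cong refl) (simp only: sum_chi_dot_diff)
  also have "\<dots> = (\<Sum>b\<in>V. f b * cnj (f b) * of_nat (order R ^ d))"
  proof (intro sum.cong refl)
    fix b assume b: "b \<in> V"
    have "(\<Sum>c\<in>V. f b * cnj (f c) * (if b = c then of_nat (order R ^ d) else 0)) =
        (\<Sum>c\<in>V. if b = c then f b * cnj (f c) * of_nat (order R ^ d) else 0)"
      by (intro sum.cong) auto
    then show "(\<Sum>c\<in>V. f b * cnj (f c) * (if b = c then of_nat (order R ^ d) else 0)) =
        f b * cnj (f b) * of_nat (order R ^ d)"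
      using b by (simp add: sum.delta)
  qed
  also have "\<dots> = complex_of_real (real (order R) ^ d * (\<Sum>b\<in>V. (cmod (f b))\<^sup>2))"
    unfolding complex_norm_square [symmetric] by (simp add: sum_distrib_left mult.commute)
  finally show ?thesis
    unfolding of_real_eq_iff .
qed

section \<open>Incidences of a set with its image under a rigid motion\<close>

definition exp_sum :: "(nat \<Rightarrow> 'a) set \<Rightarrow> (nat \<Rightarrow> 'a) \<Rightarrow> complex" where
  "exp_sum E x = (\<Sum>y\<in>E. \<chi> (\<ominus> (x \<bullet> y)))"

text \<open>The points counted by \<lambda>(b). The tuples of length \<open>k + 1\<close> of such
  points are exactly the simplices in \<open>E\<close> that the motion given by \<open>g\<close> and
  \<open>b\<close> carries into \<open>E\<close>.\<close>

definition incidences ::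
    "(nat \<Rightarrow> 'a) set \<Rightarrow> ((nat \<Rightarrow> 'a) \<Rightarrow> nat \<Rightarrow> 'a) \<Rightarrow> (nat \<Rightarrow> 'a) \<Rightarrow> (nat \<Rightarrow> 'a) set" where
  "incidences E g b = {u \<in> E. vadd (g u) b \<in> E}"

lemma finite_subset_V: "E \<subseteq> V \<Longrightarrow> finite E"
  using finite_subset finite_V by blast

lemma exp_sum_zero:
  assumes E: "E \<subseteq> V" shows "exp_sum E zv = of_nat (card E)"
proof -
  have "exp_sum E zv = (\<Sum>y\<in>E. 1)"
    unfolding exp_sum_def using E by (intro sum.cong) (auto simp: subset_iff)
  then show ?thesis by simp
qed

context
  fixes E g
  assumes E: "E \<subseteq> V" and g: "g \<in> G"
begin

text \<open>As a function of \<open>b\<close> the count is a correlation of \<open>E\<close> with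
  its image under \<open>g\<close>, so its transform factors. Writing the frequency as
  \<open>g x\<close> lets \<open>g x \<bullet> g u = x \<bullet> u\<close> turn the factor of the
  image into the exponential sum of \<open>E\<close> at \<open>x\<close>.\<close>

lemma fourier_incidences:
  assumes x: "x \<in> V"
  shows "(\<Sum>b\<in>V. of_nat (card (incidences E g b)) * \<chi> (\<ominus> (g x \<bullet> b))) = exp_sum E (g x) * cnj (exp_sum E x)"
proof -
  have "(\<Sum>b\<in>V. of_nat (card (incidences E g b)) * \<chi> (\<ominus> (g x \<bullet> b))) =
      (\<Sum>b\<in>V. \<Sum>u\<in>{u \<in> E. vadd (g u) b \<in> E}. \<chi> (\<ominus> (g x \<bullet> b)))"
    by (simp add: incidences_def)
  also have "\<dots> = (\<Sum>u\<in>E. \<Sum>b\<in>{b \<in> V. vadd (g u) b \<in> E}. \<chi> (\<ominus> (g x \<bullet> b)))"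
    by (rule sum.swap_restrict) (auto simp: finite_subset_V [OF E])
  also have "\<dots> = (\<Sum>u\<in>E. \<Sum>v\<in>E. \<chi> (\<ominus> (g x \<bullet> v)) * cnj (\<chi> (\<ominus> (x \<bullet> u))))"
  proof (rule sum.cong)
    fix u assume u: "u \<in> E"
    then have uV: "u \<in> V" "g u \<in> V" and gx: "g x \<in> V"
      using E g x by auto
    \<comment> \<open>For fixed \<open>u\<close> the translation \<open>b\<close> is replaced by the
      point \<open>v = vadd (g u) b\<close> of \<open>E\<close>.\<close>
    have "bij_betw (\<lambda>v. vsub v (g u)) E {b \<in> V. vadd (g u) b \<in> E}"
      by (rule bij_betw_byWitness [where f' = "\<lambda>b. vadd b (g u)"])
        (use uV E in \<open>auto simp: vadd_commute [of "g u"]\<close>)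
    then have "(\<Sum>b\<in>{b \<in> V. vadd (g u) b \<in> E}. \<chi> (\<ominus> (g x \<bullet> b))) = (\<Sum>v\<in>E. \<chi> (\<ominus> (g x \<bullet> vsub v (g u))))"
      by (rule sum.reindex_bij_betw [symmetric])
    also have "\<dots> = (\<Sum>v\<in>E. \<chi> (\<ominus> (g x \<bullet> v)) * cnj (\<chi> (\<ominus> (x \<bullet> u))))"
    proof (rule sum.cong)
      fix v assume "v \<in> E"
      then have v: "v \<in> V"
        using E by auto
      have "\<ominus> (g x \<bullet> vsub v (g u)) = \<ominus> (g x \<bullet> v) \<oplus> (x \<bullet> u)"
        using uV gx v x g by (simp add: dot_sub_right minus_eq minus_add)
      then show "\<chi> (\<ominus> (g x \<bullet> vsub v (g u))) = \<chi> (\<ominus> (g x \<bullet> v)) * cnj (\<chi> (\<ominus> (x \<bullet> u)))"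
        using uV gx v x by (simp add: chi_add chi_minus)
    qed simp
    finally show "(\<Sum>b\<in>{b \<in> V. vadd (g u) b \<in> E}. \<chi> (\<ominus> (g x \<bullet> b))) =
        (\<Sum>v\<in>E. \<chi> (\<ominus> (g x \<bullet> v)) * cnj (\<chi> (\<ominus> (x \<bullet> u))))" .
  qed simp
  also have "\<dots> = exp_sum E (g x) * cnj (exp_sum E x)"
    unfolding exp_sum_def cnj_sum sum_product by (rule sum.swap)
  finally show ?thesis .
qed

text \<open>This is the transform at frequency zero, which \<open>g\<close> fixes.\<close>

lemma sum_incidences: "(\<Sum>b\<in>V. real (card (incidences E g b))) = (real (card E))\<^sup>2"
proof -
  have "(\<Sum>b\<in>V. complex_of_nat (card (incidences E g b))) =
      (\<Sum>b\<in>V. of_nat (card (incidences E g b)) * \<chi> (\<ominus> (g zv \<bullet> b)))"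
    using g by (intro sum.cong) (simp_all add: G_zero)
  also have "\<dots> = of_nat (card E) * of_nat (card E)"
    using g by (subst fourier_incidences) (simp_all add: G_zero exp_sum_zero [OF E] vec_closed)
  finally have "complex_of_nat (\<Sum>b\<in>V. card (incidences E g b)) = of_nat (card E * card E)"
    by simp
  then have "(\<Sum>b\<in>V. card (incidences E g b)) = card E * card E"
    by (simp only: of_nat_eq_iff)
  then show ?thesis
    by (simp add: power2_eq_square flip: of_nat_sum of_nat_mult)
qed

text \<open>Plancherel produces the products of the squared moduli of \<open>exp_sum E\<close> at
  \<open>g x\<close> and at \<open>x\<close>. Frequency zero gives the main term. Elsewhere AM--GM
  splits the product into two halves of fourth powers, and these have equal sums because
  \<open>g\<close> permutes the nonzero frequencies; so \<open>g\<close> disappears from the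
  bound.\<close>

lemma sum_incidences_squared:
  "real (order R) ^ d * (\<Sum>b\<in>V. (real (card (incidences E g b)))\<^sup>2) \<le>
     real (card E) ^ 4 + (\<Sum>x\<in>V - {zv}. cmod (exp_sum E x) ^ 4)"
proof -
  let ?S = "\<lambda>x. cmod (exp_sum E x)"
  have bij: "bij_betw g V V"
    using G_bij g by blast
  have bij0: "bij_betw g (V - {zv}) (V - {zv})"
    using bij_betw_DiffI [OF bij, of "{zv}" "{zv}"] G_zero [OF g]
    by (simp add: bij_betw_def)
  have "real (order R) ^ d * (\<Sum>b\<in>V. (real (card (incidences E g b)))\<^sup>2) =
      (\<Sum>x\<in>V. (cmod (\<Sum>b\<in>V. of_nat (card (incidences E g b)) * \<chi> (\<ominus> (x \<bullet> b))))\<^sup>2)"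
    by (subst plancherel) simp
  also have "\<dots> = (\<Sum>x\<in>V. (cmod (\<Sum>b\<in>V. of_nat (card (incidences E g b)) * \<chi> (\<ominus> (g x \<bullet> b))))\<^sup>2)"
    by (rule sum.reindex_bij_betw [OF bij, symmetric])
  also have "\<dots> = (\<Sum>x\<in>V. (?S (g x))\<^sup>2 * (?S x)\<^sup>2)"
    by (rule sum.cong) (simp_all add: fourier_incidences norm_mult power_mult_distrib)
  also have "\<dots> = real (card E) ^ 4 + (\<Sum>x\<in>V - {zv}. (?S (g x))\<^sup>2 * (?S x)\<^sup>2)"
    by (subst sum.remove [of _ zv]) (simp_all add: vec_closed G_zero [OF g] exp_sum_zero [OF E] flip: power_add)
  also have "(\<Sum>x\<in>V - {zv}. (?S (g x))\<^sup>2 * (?S x)\<^sup>2) \<le> (\<Sum>x\<in>V - {zv}. ?S (g x) ^ 4 / 2 + ?S x ^ 4 / 2)"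
  proof (rule sum_mono)
    fix x
    have "0 \<le> ((?S (g x))\<^sup>2 - (?S x)\<^sup>2)\<^sup>2"
      by simp
    also have "\<dots> = ?S (g x) ^ 4 + ?S x ^ 4 - 2 * ((?S (g x))\<^sup>2 * (?S x)\<^sup>2)"
      by (simp add: power2_diff flip: power_mult)
    finally show "(?S (g x))\<^sup>2 * (?S x)\<^sup>2 \<le> ?S (g x) ^ 4 / 2 + ?S x ^ 4 / 2"
      by simp
  qed
  also have "\<dots> = (\<Sum>x\<in>V - {zv}. ?S x ^ 4)"
    using sum.reindex_bij_betw [OF bij0, of "\<lambda>x. ?S x ^ 4"]
    by (simp add: sum.distrib flip: sum_divide_distrib)
  finally show ?thesis by simp
qed

text \<open>The subtracted constant is the mean over the \<open>order R ^ d\<close> translations,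
  and subtracting it removes exactly the contribution of frequency zero.\<close>

lemma incidence_variance:
  "(\<Sum>b\<in>V. (real (card (incidences E g b)) - (real (card E))\<^sup>2 / real (order R) ^ d)\<^sup>2) \<le>
     (\<Sum>x\<in>V - {zv}. cmod (exp_sum E x) ^ 4) / real (order R) ^ d" (is "?L \<le> ?D / ?q")
proof -
  let ?l = "\<lambda>b. real (card (incidences E g b))"
  let ?m = "(real (card E))\<^sup>2 / ?q"
  have q: "?q > 0"
    using q_pos by simp
  have "?L = (\<Sum>b\<in>V. (?l b)\<^sup>2 - 2 * ?m * ?l b + ?m\<^sup>2)"
    by (rule sum.cong) (simp_all add: power2_diff algebra_simps)
  also have "\<dots> = (\<Sum>b\<in>V. (?l b)\<^sup>2) - 2 * ?m * (\<Sum>b\<in>V. ?l b) + ?q * ?m\<^sup>2"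
    unfolding sum.distrib sum_subtractf sum_distrib_left [symmetric] by (simp add: card_V)
  also have "\<dots> = (\<Sum>b\<in>V. (?l b)\<^sup>2) - real (card E) ^ 4 / ?q"
    using q by (simp add: sum_incidences power2_eq_square power4_eq_xxxx field_simps)
  finally have "?q * ?L = ?q * (\<Sum>b\<in>V. (?l b)\<^sup>2) - real (card E) ^ 4"
    using q by (simp add: right_diff_distrib)
  also have "\<dots> \<le> ?D"
    using sum_incidences_squared by simp
  finally show ?thesis
    using q by (simp add: field_simps)
qed

text \<open>Where the count is at most twice the mean, the first term bounds its power. Where it is
  larger, it is at most twice its deviation from the mean: two of the \<open>k + 1\<close> factors
  give 4 times the squared deviation, and the remaining \<open>k - 1\<close> are at most
  \<open>card E\<close>.\<close>

lemma incidence_moment: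
  assumes k: "1 \<le> k"
  shows "(\<Sum>b\<in>V. real (card (incidences E g b)) ^ (k + 1)) \<le>
     2 ^ (k + 1) * (real (order R) ^ d * ((real (card E))\<^sup>2 / real (order R) ^ d) ^ (k + 1)) +
     4 * real (card E) ^ (k - 1) * ((\<Sum>x\<in>V - {zv}. cmod (exp_sum E x) ^ 4) / real (order R) ^ d)"
    (is "_ \<le> 2 ^ (k + 1) * (?q * ?m ^ (k + 1)) + 4 * ?e ^ (k - 1) * ?D")
proof -
  let ?l = "\<lambda>b. real (card (incidences E g b))"
  have m: "?m \<ge> 0"
    by simp
  have "?l b ^ (k + 1) \<le> 2 ^ (k + 1) * ?m ^ (k + 1) + 4 * ?e ^ (k - 1) * (?l b - ?m)\<^sup>2" for b
  proof (cases "?l b \<le> 2 * ?m")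
    case True
    then have "?l b ^ (k + 1) \<le> (2 * ?m) ^ (k + 1)"
      by (intro power_mono) auto
    also have "\<dots> = 2 ^ (k + 1) * ?m ^ (k + 1)"
      by (rule power_mult_distrib)
    also have "\<dots> \<le> 2 ^ (k + 1) * ?m ^ (k + 1) + 4 * ?e ^ (k - 1) * (?l b - ?m)\<^sup>2"
      by simp
    finally show ?thesis .
  next
    case False
    have le: "?l b \<le> ?e"
      by (simp add: incidences_def card_mono finite_subset_V [OF E])
    have "(?l b)\<^sup>2 \<le> (2 * (?l b - ?m))\<^sup>2"
      using False by (intro power_mono) auto
    then have "?l b ^ (k - 1) * (?l b)\<^sup>2 \<le> ?e ^ (k - 1) * (2 * (?l b - ?m))\<^sup>2"
      using le by (intro mult_mono [OF power_mono]) auto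
    moreover have "?l b ^ (k + 1) = ?l b ^ (k - 1) * (?l b)\<^sup>2"
      using k by (simp flip: power_add)
    moreover have "0 \<le> 2 ^ (k + 1) * ?m ^ (k + 1)"
      using m by simp
    moreover have "?e ^ (k - 1) * (2 * (?l b - ?m))\<^sup>2 = 4 * ?e ^ (k - 1) * (?l b - ?m)\<^sup>2"
      unfolding power_mult_distrib by simp
    ultimately show ?thesis
      by linarith
  qed
  then have "(\<Sum>b\<in>V. ?l b ^ (k + 1)) \<le>
      (\<Sum>b\<in>V. 2 ^ (k + 1) * ?m ^ (k + 1) + 4 * ?e ^ (k - 1) * (?l b - ?m)\<^sup>2)"
    by (rule sum_mono)
  also have "\<dots> = 2 ^ (k + 1) * (?q * ?m ^ (k + 1)) + 4 * ?e ^ (k - 1) * (\<Sum>b\<in>V. (?l b - ?m)\<^sup>2)"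
    by (simp add: sum.distrib card_V flip: sum_distrib_left)
  also have "\<dots> \<le> 2 ^ (k + 1) * (?q * ?m ^ (k + 1)) + 4 * ?e ^ (k - 1) * ?D"
    by (intro add_left_mono mult_left_mono incidence_variance) auto
  finally show ?thesis .
qed

end

section \<open>Counting congruence classes\<close>

definition congruence :: "nat \<Rightarrow> (nat \<Rightarrow> 'a) set \<Rightarrow> ((nat \<Rightarrow> nat \<Rightarrow> 'a) \<times> (nat \<Rightarrow> nat \<Rightarrow> 'a)) set" where
  "congruence k E =
     {(x, y). x \<in> simplices k E \<and> y \<in> simplices k E \<and> congruent_simplices R d k x y}"

context
  fixes E :: "(nat \<Rightarrow> 'a) set" and k :: nat
  assumes E: "E \<subseteq> V"
begin

lemma simplices_V: "x \<in> simplices k E \<Longrightarrow> i \<le> k \<Longrightarrow> x i \<in> V"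
  using E by (auto simp: simplices_def PiE_iff)

lemma finite_simplices: "finite (simplices k E)"
  unfolding simplices_def using finite_subset_V [OF E] by (simp add: finite_PiE)

lemma congruence_iff:
  "(x, y) \<in> congruence k E \<longleftrightarrow> x \<in> simplices k E \<and> y \<in> simplices k E \<and>
     (\<exists>g\<in>G. \<exists>b\<in>V. \<forall>i\<le>k. vadd (g (x i)) b = y i)"
  unfolding congruence_def using congruent_simplices_iff [of k x y] simplices_V by auto

lemma equiv_congruence: "equiv (simplices k E) (congruence k E)"
proof (rule equivI)
  show "congruence k E \<subseteq> simplices k E \<times> simplices k E"
    by (auto simp: congruence_def)
  show "refl_on (simplices k E) (congruence k E)"
  proof (rule refl_onI)
    fix x assume x: "x \<in> simplices k E"
    have "\<forall>i\<le>k. vadd (restrict id V (x i)) zv = x i"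
    proof clarify
      fix i assume "i \<le> k"
      then have "x i \<in> V"
        using x simplices_V by blast
      then show "vadd (restrict id V (x i)) zv = x i"
        by (intro vector_eqI) (simp_all add: vec_closed vector_comp)
    qed
    then show "(x, x) \<in> congruence k E"
      using x G_id vec_closed(4) unfolding congruence_iff by blast
  qed
  show "sym (congruence k E)"
  proof (rule symI)
    fix x y assume xy: "(x, y) \<in> congruence k E"
    then obtain g b where gb: "g \<in> G" "b \<in> V" "\<forall>i\<le>k. vadd (g (x i)) b = y i"
      unfolding congruence_iff by blast
    obtain h where h: "h \<in> G" "\<And>x. x \<in> V \<Longrightarrow> h (g x) = x"
      using G_inverse [OF gb(1)] by blast
    have hb: "h b \<in> V"
      using h gb by blast
    \<comment> \<open>The inverse of the motion given by \<open>g\<close> and \<open>b\<close> has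
      linear part \<open>h\<close> and translation the negative of \<open>h b\<close>.\<close>
    have "\<forall>i\<le>k. vadd (h (y i)) (vsub zv (h b)) = x i"
    proof clarify
      fix i assume i: "i \<le> k"
      then have x: "x i \<in> V"
        using xy simplices_V unfolding congruence_iff by blast
      have "h (y i) = vadd (x i) (h b)"
        using gb i h x by (metis G_add G_closed)
      then show "vadd (h (y i)) (vsub zv (h b)) = x i"
        using x hb by (intro vector_eqI) (simp_all add: vec_closed vector_comp minus_eq a_assoc r_neg)
    qed
    moreover have "vsub zv (h b) \<in> V"
      using hb by (simp add: vec_closed)
    ultimately show "(y, x) \<in> congruence k E"
      using xy h(1) unfolding congruence_iff by blast
  qed
  show "trans (congruence k E)"
  proof (rule transI)
    fix x y z assume xy: "(x, y) \<in> congruence k E" and yz: "(y, z) \<in> congruence k E"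
    obtain g b where gb: "g \<in> G" "b \<in> V" "\<forall>i\<le>k. vadd (g (x i)) b = y i"
      using xy unfolding congruence_iff by blast
    obtain h c where hc: "h \<in> G" "c \<in> V" "\<forall>i\<le>k. vadd (h (y i)) c = z i"
      using yz unfolding congruence_iff by blast
    have hb: "h b \<in> V"
      using hc gb by blast
    have "\<forall>i\<le>k. vadd (compose V h g (x i)) (vadd (h b) c) = z i"
    proof clarify
      fix i assume i: "i \<le> k"
      then have x: "x i \<in> V" "g (x i) \<in> V" "h (g (x i)) \<in> V"
        using xy simplices_V gb(1) hc(1) unfolding congruence_iff by blast+
      have "z i = vadd (h (vadd (g (x i)) b)) c"
        using gb hc i by simp
      also have "\<dots> = vadd (vadd (h (g (x i))) (h b)) c"
        using gb hc x by (simp add: G_add)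
      also have "\<dots> = vadd (h (g (x i))) (vadd (h b) c)"
        using hc x hb by (simp add: vadd_assoc)
      finally show "vadd (compose V h g (x i)) (vadd (h b) c) = z i"
        using x by (simp add: compose_eq)
    qed
    moreover have "vadd (h b) c \<in> V"
      using hb hc by (simp add: vec_closed)
    ultimately show "(x, z) \<in> congruence k E"
      using xy yz G_compose [OF hc(1) gb(1)] unfolding congruence_iff by blast
  qed
qed

text \<open>From one motion taking \<open>x\<close> to \<open>y\<close>, every \<open>h\<close>
  fixing the edge vectors at vertex 0 yields another, with linear part \<open>g\<close> after
  \<open>h\<close>; its translation is forced by vertex 0. Distinct \<open>h\<close> give distinct
  linear parts.\<close>

lemma card_motions_ge:
  assumes odd: "odd (order R)" and kd: "k \<le> d" and xy: "(x, y) \<in> congruence k E"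
  shows "card G \<le> card {(g, b) \<in> G \<times> V. \<forall>i\<le>k. vadd (g (x i)) b = y i} *
    (2 ^ k * order R ^ (k * d - ((k + 1) choose 2)))" (is "_ \<le> card ?M * ?B")
proof -
  obtain g b where gb: "g \<in> G" "b \<in> V" "\<forall>i\<le>k. vadd (g (x i)) b = y i"
    using xy unfolding congruence_iff by blast
  have xV: "x i \<in> V" if "i \<le> k" for i
    using xy that simplices_V unfolding congruence_iff by blast
  have yV: "y i \<in> V" if "i \<le> k" for i
    using xy that simplices_V unfolding congruence_iff by blast
  define X where "X = (\<lambda>i. vsub (x i) (x 0)) ` {1..k}"
  have X: "finite X" "X \<subseteq> V" "card X \<le> k"
    using xV card_image_le [of "{1..k}"] by (auto simp: X_def)
  have "card (fixer X) \<le> card ?M"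
  proof (rule card_inj_on_le [where f = "\<lambda>h. (compose V g h, vsub (y 0) (g (h (x 0))))"])
    show "finite ?M"
      by (rule finite_subset [of _ "G \<times> V"]) auto
    show "inj_on (\<lambda>h. (compose V g h, vsub (y 0) (g (h (x 0))))) (fixer X)"
    proof (rule inj_onI)
      fix h h' assume h: "h \<in> fixer X" "h' \<in> fixer X"
        and eq: "(compose V g h, vsub (y 0) (g (h (x 0)))) = (compose V g h', vsub (y 0) (g (h' (x 0))))"
      have hG: "h \<in> G" "h' \<in> G"
        using h by (auto simp: fixer_def)
      then show "h = h'"
      proof (rule G_eqI)
        fix z assume z: "z \<in> V"
        have "compose V g h = compose V g h'"
          using eq by simp
        from fun_cong [OF this, of z] have "g (h z) = g (h' z)"
          using z by (simp add: compose_eq)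
        then show "h z = h' z"
          using G_bij [OF gb(1)] hG z by (auto simp: bij_betw_def inj_on_def)
      qed
    qed
    show "(\<lambda>h. (compose V g h, vsub (y 0) (g (h (x 0))))) ` fixer X \<subseteq> ?M"
    proof (rule image_subsetI)
      fix h assume h: "h \<in> fixer X"
      then have hG: "h \<in> G"
        by (simp add: fixer_def)
      let ?b = "vsub (y 0) (g (h (x 0)))"
      have ghV: "g (h (x i)) \<in> V" "h (x i) \<in> V" "g (x i) \<in> V" if "i \<le> k" for i
        using xV [OF that] hG gb(1) by auto
      have bV: "?b \<in> V"
        using yV ghV by (simp add: vec_closed)
      have "vadd (compose V g h (x i)) ?b = y i" if i: "i \<le> k" for i
      proof -
        \<comment> \<open>\<open>X\<close> collects only the edges to vertices 1 up to
          \<open>k\<close>, so that it has at most \<open>k\<close> elements; at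
          \<open>i = 0\<close> the edge is the zero vector.\<close>
        have fix_diff: "h (vsub (x i) (x 0)) = vsub (x i) (x 0)"
        proof (cases "i = 0")
          case True
          have "vsub (x 0) (x 0) = zv"
            using vsub_eq_zero_iff [OF xV xV, of 0 0] by simp
          then show ?thesis
            using True G_zero [OF hG] by simp
        next
          case False
          then show ?thesis
            using h i by (auto simp: fixer_def X_def)
        qed
        have diff: "vsub (g (h (x i))) (g (h (x 0))) = vsub (g (x i)) (g (x 0))"
          using fix_diff xV i ghV hG gb(1) by (metis G_sub le0)
        have y0: "y 0 = vadd (g (x 0)) b" and yi: "y i = vadd (g (x i)) b"
          using gb(3) i by auto
        have "vadd (g (h (x i))) ?b = vadd (vsub (g (h (x i))) (g (h (x 0)))) (y 0)"
          using ghV [OF i] ghV [of 0] yV [of 0] bV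
          by (intro vector_eqI) (simp_all add: vec_closed vector_comp minus_eq a_ac)
        also have "\<dots> = vadd (vsub (g (x i)) (g (x 0))) (vadd (g (x 0)) b)"
          unfolding diff y0 ..
        also have "\<dots> = vadd (g (x i)) b"
          using ghV [OF i] ghV [of 0] gb(2)
          by (subst vadd_assoc [symmetric]) (simp_all add: vec_closed)
        finally show ?thesis
          using xV [OF i] yi by (simp add: compose_eq)
      qed
      then show "(compose V g h, ?b) \<in> ?M"
        using bV G_compose [OF gb(1) hG] by simp
    qed
  qed
  moreover have "card G \<le> card (fixer X) * ?B"
    by (rule card_G_le_fixer [OF odd X kd])
  ultimately show ?thesis
    by (meson mult_le_mono1 order_trans)
qed

text \<open>For a fixed motion the first simplex determines the second, and all its vertices lie in
  \<open>incidences E g b\<close>.\<close>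

lemma card_congruent_pairs_le:
  assumes g: "g \<in> G" and b: "b \<in> V"
  shows "card {(x, y) \<in> congruence k E. \<forall>i\<le>k. vadd (g (x i)) b = y i} \<le> card (incidences E g b) ^ (k + 1)"
    (is "card ?P \<le> _")
proof -
  let ?T = "{..k} \<rightarrow>\<^sub>E incidences E g b"
  have fin: "finite (incidences E g b)"
    using finite_subset_V [OF E] by (simp add: incidences_def)
  have "card ?P \<le> card ?T"
  proof (rule card_inj_on_le [where f = fst])
    show "finite ?T"
      using fin by (simp add: finite_PiE)
    show "fst ` ?P \<subseteq> ?T"
    proof clarify
      fix x y assume xy: "(x, y) \<in> congruence k E" and eq: "\<forall>i\<le>k. vadd (g (x i)) b = y i"
      have "x \<in> {..k} \<rightarrow>\<^sub>E E" "y \<in> {..k} \<rightarrow>\<^sub>E E"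
        using xy by (auto simp: congruence_def simplices_def)
      then show "fst (x, y) \<in> ?T"
        using eq by (auto simp: incidences_def PiE_iff)
    qed
    show "inj_on fst ?P"
    proof (rule inj_onI)
      fix p p' assume p: "p \<in> ?P" "p' \<in> ?P" "fst p = fst p'"
      then have "snd p \<in> {..k} \<rightarrow>\<^sub>E E" "snd p' \<in> {..k} \<rightarrow>\<^sub>E E"
        by (auto simp: congruence_def simplices_def)
      moreover have "snd p i = snd p' i" if "i \<in> {..k}" for i
        using p that by (auto simp: split_beta)
      ultimately have "snd p = snd p'"
        by (rule PiE_ext)
      then show "p = p'"
        using p(3) by (simp add: prod_eq_iff)
    qed
  qed
  also have "\<dots> = card (incidences E g b) ^ (k + 1)"
    by (simp add: card_PiE)
  finally show ?thesis .
qed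

text \<open>Double counting of congruent pairs together with a motion realizing them: each pair has
  at least \<open>card G\<close> divided by the stabilizer factor many motions, and each motion
  realizes at most a power of its incidence count of pairs.\<close>

lemma card_congruence_le:
  assumes odd: "odd (order R)" and kd: "k \<le> d"
  shows "card (congruence k E) * card G \<le>
    (2 ^ k * order R ^ (k * d - ((k + 1) choose 2))) *
    (\<Sum>g\<in>G. \<Sum>b\<in>V. card (incidences E g b) ^ (k + 1))" (is "_ \<le> ?B * _")
proof -
  let ?m = "\<lambda>p q. \<forall>i\<le>k. vadd (fst q (fst p i)) (snd q) = snd p i"
  have finC: "finite (congruence k E)"
    by (rule finite_subset [of _ "simplices k E \<times> simplices k E"])
      (auto simp: congruence_def finite_simplices)
  have "card (congruence k E) * card G = (\<Sum>p\<in>congruence k E. card G)"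
    by simp
  also have "\<dots> \<le> (\<Sum>p\<in>congruence k E. card {q \<in> G \<times> V. ?m p q} * ?B)"
  proof (rule sum_mono)
    fix p assume p: "p \<in> congruence k E"
    have "{(g, b) \<in> G \<times> V. \<forall>i\<le>k. vadd (g (fst p i)) b = snd p i} = {q \<in> G \<times> V. ?m p q}"
      by auto
    then show "card G \<le> card {q \<in> G \<times> V. ?m p q} * ?B"
      using card_motions_ge [OF odd kd, of "fst p" "snd p"] p by simp
  qed
  also have "\<dots> = ?B * (\<Sum>p\<in>congruence k E. card {q \<in> G \<times> V. ?m p q})"
    by (simp add: sum_distrib_left mult.commute)
  also have "(\<Sum>p\<in>congruence k E. card {q \<in> G \<times> V. ?m p q}) =
      (\<Sum>q\<in>G \<times> V. card {p \<in> congruence k E. ?m p q})"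
    using sum.swap_restrict [OF finC, of "G \<times> V" "\<lambda>_ _. 1::nat" ?m] by simp
  also have "\<dots> \<le> (\<Sum>q\<in>G \<times> V. card (incidences E (fst q) (snd q)) ^ (k + 1))"
  proof (rule sum_mono)
    fix q assume q: "q \<in> G \<times> V"
    have "{(x, y) \<in> congruence k E. \<forall>i\<le>k. vadd (fst q (x i)) (snd q) = y i} = {p \<in> congruence k E. ?m p q}"
      by auto
    then show "card {p \<in> congruence k E. ?m p q} \<le> card (incidences E (fst q) (snd q)) ^ (k + 1)"
      using card_congruent_pairs_le [of "fst q" "snd q"] q by auto
  qed
  also have "\<dots> = (\<Sum>g\<in>G. \<Sum>b\<in>V. card (incidences E g b) ^ (k + 1))"
    by (simp add: sum.cartesian_product split_beta)
  finally show ?thesis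
    by simp
qed

text \<open>The moment bound does not involve \<open>g\<close>, so summing it over \<open>G\<close>
  only produces a factor \<open>card G\<close>, which cancels. Cauchy--Schwarz over the classes
  finishes the estimate.\<close>

lemma card_congruence_classes_ge:
  assumes odd: "odd (order R)" and k: "1 \<le> k" "k \<le> d"
  shows "real (card E) ^ (2 * (k + 1)) \<le> real (card (congruence_classes R d k E)) *
    (2 ^ k * real (order R) ^ (k * d - ((k + 1) choose 2)) *
      (2 ^ (k + 1) * (real (order R) ^ d * ((real (card E))\<^sup>2 / real (order R) ^ d) ^ (k + 1)) +
       4 * real (card E) ^ (k - 1) * ((\<Sum>x\<in>V - {zv}. cmod (exp_sum E x) ^ 4) / real (order R) ^ d)))"
    (is "_ \<le> ?T * (?B * ?M)")
proof -
  have G: "real (card G) > 0"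
    using G_id finite_G by (auto simp: card_gt_0_iff)
  have "real (card (congruence k E)) * real (card G) \<le>
      ?B * (\<Sum>g\<in>G. \<Sum>b\<in>V. real (card (incidences E g b)) ^ (k + 1))"
    using of_nat_mono [OF card_congruence_le [OF odd k(2)], where 'a = real] by simp
  also have "\<dots> \<le> ?B * (\<Sum>g\<in>G. ?M)"
    by (intro mult_left_mono sum_mono incidence_moment [OF E _ k(1)]) auto
  also have "\<dots> = (?B * ?M) * real (card G)"
    by simp
  finally have N: "real (card (congruence k E)) \<le> ?B * ?M"
    using G by simp
  have "real (card E) ^ (2 * (k + 1)) = (real (card (simplices k E)))\<^sup>2"
    by (simp add: simplices_def card_PiE power2_eq_square mult_2 power_add)
  also have "\<dots> \<le> ?T * real (card (congruence k E))"
    using card_squared_le_quotient [OF equiv_congruence finite_simplices]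
    by (simp add: congruence_classes_def congruence_def)
  also have "\<dots> \<le> ?T * (?B * ?M)"
    using N by (rule mult_left_mono) simp
  finally show ?thesis .
qed

end

text \<open>\<open>exp_sum\<close> is the Fourier transform without its normalization by
  \<open>order R ^ d\<close>; the fourth power of that factor appears here beside the averaging
  factor of the norm.\<close>

lemma fourier_norm4_power4:
  "fourier_norm4 R \<chi> d E ^ 4 =
     (\<Sum>x\<in>V - {zv}. cmod (exp_sum E x) ^ 4) / real (order R) ^ d / real (order R) ^ (4 * d)"
proof -
  have "(\<Sum>x\<in>V - {zv}. cmod (fourier_transform R \<chi> d E x) ^ 4) =
      (\<Sum>x\<in>V - {zv}. cmod (exp_sum E x) ^ 4 / real (order R) ^ (4 * d))"
    by (rule sum.cong)
      (simp_all add: fourier_transform_def exp_sum_def norm_divide norm_power power_divide mult.commute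
        flip: power_mult)
  then have eq: "(\<Sum>x\<in>V - {zv}. cmod (fourier_transform R \<chi> d E x) ^ 4) / real (order R) ^ d =
      (\<Sum>x\<in>V - {zv}. cmod (exp_sum E x) ^ 4) / real (order R) ^ d / real (order R) ^ (4 * d)" (is "_ = ?A")
    by (simp add: mult.commute flip: sum_divide_distrib)
  have "?A \<ge> 0"
    by (intro divide_nonneg_nonneg sum_nonneg) auto
  then have "(?A powr (1/4)) ^ 4 = ?A"
    by (rule powr_quarter_power4)
  then show ?thesis
    unfolding fourier_norm4_def eq .
qed

end

section \<open>Comparing the counting inequality with the claimed minimum\<close>

lemma min_le_of_simplex_bound:
  fixes q n T D c s :: real and k d m :: nat
  assumes q: "q \<ge> 1" and n: "n > 0" and T: "T \<ge> 0" and k: "1 \<le> k" and m: "m \<le> k * d"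
    and D: "D \<le> c ^ 4 * (n powr (1 - s)) ^ 4"
    and bound: "n ^ (2 * (k + 1)) \<le>
      T * (2 ^ k * q ^ (k * d - m) * (2 ^ (k + 1) * (q ^ d * (n\<^sup>2 / q ^ d) ^ (k + 1)) + 4 * n ^ (k - 1) * D))"
  shows "min (q powr real m) (n powr (real k - 1 + 4 * s) * q powr (real m - real k * real d))
    \<le> 2 ^ k * (2 ^ (k + 1) + 4 * c ^ 4) * T"
proof -
  \<comment> \<open>\<open>M\<close> is the claimed minimum, \<open>Q\<close> the stabilizer factor
    without its constant, and \<open>X\<close> and \<open>Y\<close> the contributions of mean and
    variance. Each entry of the minimum balances one of them: the first gives
    \<open>M * Q * X \<le> N\<close>, the second \<open>M * Q * Y \<le> N\<close>. Multiplying
    \<open>bound\<close> by \<open>M\<close> then leaves a common factor \<open>N\<close> to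
    cancel.\<close>
  define M where "M = min (q powr real m) (n powr (real k - 1 + 4 * s) * q powr (real m - real k * real d))"
  define N where "N = n ^ (2 * (k + 1))"
  define Q where "Q = q ^ (k * d - m)"
  define X where "X = q ^ d * (n\<^sup>2 / q ^ d) ^ (k + 1)"
  define Y where "Y = n ^ (k - 1) * (n powr (1 - s)) ^ 4"
  have pos: "M > 0" "N > 0" "Q > 0" "Y > 0"
    using q n by (simp_all add: M_def N_def Q_def Y_def)
  have X: "X = N / q ^ (k * d)"
  proof -
    have "X = q ^ d * (N / (q ^ d * (q ^ d) ^ k))"
      unfolding X_def N_def power_divide power_mult by simp
    also have "\<dots> = N / (q ^ d) ^ k"
      using q by simp
    finally show ?thesis
      by (simp add: mult.commute flip: power_mult)
  qed
  have "M * Q * X \<le> q powr real m * Q * X"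
    using q pos X by (intro mult_right_mono) (auto simp: M_def)
  also have "\<dots> = N * (q ^ (m + (k * d - m)) / q ^ (k * d))"
    using q by (simp add: powr_realpow Q_def X power_add)
  also have "\<dots> = N"
    using q m by simp
  finally have MX: "M * Q * X \<le> N" .
  have Q: "Q = q powr (real k * real d - real m)"
    using q m by (simp add: Q_def of_nat_diff flip: powr_realpow)
  have Y: "Y = n powr (real k + 3 - 4 * s)"
  proof -
    have "n ^ (k - 1) = n powr (real k - 1)"
      using n k by (simp add: of_nat_diff flip: powr_realpow)
    moreover have "(n powr (1 - s)) ^ 4 = n powr (4 * (1 - s))"
      using n by (simp add: powr_powr mult.commute flip: powr_numeral)
    ultimately have "Y = n powr ((real k - 1) + 4 * (1 - s))"
      by (simp only: Y_def powr_add)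
    then show ?thesis
      by (simp add: algebra_simps)
  qed
  have N: "N = n powr (2 * real k + 2)"
    unfolding N_def powr_realpow [OF n, symmetric] by (simp add: algebra_simps)
  have "M * Q * Y \<le> n powr (real k - 1 + 4 * s) * q powr (real m - real k * real d) * Q * Y"
    using pos by (intro mult_right_mono) (auto simp: M_def)
  also have "\<dots> = n powr ((real k - 1 + 4 * s) + (real k + 3 - 4 * s)) *
      q powr ((real m - real k * real d) + (real k * real d - real m))"
    unfolding Q Y powr_add by (simp only: mult_ac)
  also have "\<dots> = N"
    using q by (simp add: N algebra_simps)
  finally have MY: "M * Q * Y \<le> N" .
  have "M * N \<le> M * (T * (2 ^ k * Q * (2 ^ (k + 1) * X + 4 * n ^ (k - 1) * D)))"
    using bound pos by (intro mult_left_mono) (auto simp: N_def Q_def X_def)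
  also have "\<dots> \<le> M * (T * (2 ^ k * Q * (2 ^ (k + 1) * X + 4 * n ^ (k - 1) * (c ^ 4 * (n powr (1 - s)) ^ 4))))"
    using D pos n T by (intro mult_left_mono add_left_mono) auto
  also have "\<dots> = T * 2 ^ k * (2 ^ (k + 1) * (M * Q * X) + 4 * c ^ 4 * (M * Q * Y))"
    by (simp add: Y_def algebra_simps)
  also have "\<dots> \<le> T * 2 ^ k * (2 ^ (k + 1) * N + 4 * c ^ 4 * N)"
    using MX MY T by (intro mult_left_mono add_mono) auto
  also have "\<dots> = (2 ^ k * (2 ^ (k + 1) + 4 * c ^ 4) * T) * N"
    by (simp add: algebra_simps)
  finally show ?thesis
    using pos by (simp add: M_def)
qed

text \<open>At exponent 1/2 the power of \<open>n\<close> in the second entry is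
  \<open>k + 1\<close>, and raising the density hypothesis to that power compares it with
  \<open>q powr (real k * real d)\<close>. The constant \<open>1 + c ^ (k + 1)\<close> serves both
  entries of the minimum.\<close>

lemma powr_le_of_min_bound:
  fixes q n c :: real and k d m :: nat
  assumes q: "q \<ge> 1" and c: "c > 0" and n: "q powr (real k * real d / (real k + 1)) \<le> c * n"
  shows "q powr real m \<le> (1 + c ^ (k + 1)) *
    min (q powr real m) (n powr (real k - 1 + 4 * (1/2)) * q powr (real m - real k * real d))"
proof -
  let ?B = "n powr (real k - 1 + 4 * (1/2)) * q powr (real m - real k * real d)"
  have "0 < c * n"
    using n q by (smt (verit) powr_gt_zero)
  then have npos: "n > 0"
    using c by (simp add: zero_less_mult_iff)
  have "q powr (real k * real d) = (q powr (real k * real d / (real k + 1))) powr (real k + 1)"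
    by (simp add: powr_powr)
  also have "\<dots> \<le> (c * n) powr (real k + 1)"
    using n by (intro powr_mono2) auto
  also have "\<dots> = c ^ (k + 1) * n powr (real k + 1)"
    using c npos powr_realpow [of c "k + 1"] by (simp add: powr_mult add.commute)
  finally have "q powr (real k * real d) * q powr (real m - real k * real d) \<le>
      c ^ (k + 1) * n powr (real k + 1) * q powr (real m - real k * real d)"
    by (rule mult_right_mono) simp
  moreover have "q powr (real k * real d) * q powr (real m - real k * real d) = q powr real m"
    by (simp flip: powr_add)
  moreover have "?B = n powr (real k + 1) * q powr (real m - real k * real d)"
    by (simp add: algebra_simps)
  ultimately have B: "q powr real m \<le> c ^ (k + 1) * ?B"
    by (simp only: mult.assoc)
  have C: "c ^ (k + 1) \<ge> 0"
    using c by simp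
  have "q powr real m \<le> (1 + c ^ (k + 1)) * q powr real m"
    using mult_right_mono [of 1 "1 + c ^ (k + 1)" "q powr real m"] C by simp
  moreover have "q powr real m \<le> (1 + c ^ (k + 1)) * ?B"
    using B unfolding distrib_right by (intro order_trans [OF B]) simp
  ultimately show ?thesis
    unfolding min_def by (simp only: split: if_split) blast
qed

section \<open>Assembling the estimates with constants uniform over the family\<close>

theorem theorem9p7:
  fixes I :: "'i set"
    and F :: "'i \<Rightarrow> 'a ring"
    and \<chi> :: "'i \<Rightarrow> 'a \<Rightarrow> complex"
    and E :: "'i \<Rightarrow> (nat \<Rightarrow> 'a) set"
    and d k :: nat
  assumes "1 \<le> k" and "k \<le> d"
    and "\<And>i. i \<in> I \<Longrightarrow> field (F i)"
    and "\<And>i. i \<in> I \<Longrightarrow> finite (carrier (F i))"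
    and "\<And>i. i \<in> I \<Longrightarrow> odd (order (F i))"
    and "\<And>i. i \<in> I \<Longrightarrow> nontrivial_additive_character (F i) (\<chi> i)"
    and "\<And>i. i \<in> I \<Longrightarrow> E i \<subseteq> vectors (F i) d"
  shows
    "(\<forall>s. salem4 I F \<chi> d s E \<longrightarrow>
        lesssim I
          (\<lambda>i. min (real (order (F i)) powr real ((k + 1) choose 2))
                   (real (card (E i)) powr (real k - 1 + 4 * s) *
                    real (order (F i)) powr (real ((k + 1) choose 2) - real k * real d)))
          (\<lambda>i. real (card (congruence_classes (F i) d k (E i)))))
     \<and>
     (lesssim I (\<lambda>i. real (order (F i)) powr (real k * real d / (real k + 1)))
                (\<lambda>i. real (card (E i))) \<and>
      salem4 I F \<chi> d (1/2) E \<longrightarrow>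
        lesssim I (\<lambda>i. real (order (F i)) powr real ((k + 1) choose 2))
                  (\<lambda>i. real (card (congruence_classes (F i) d k (E i)))))"
proof -
  let ?m = "(k + 1) choose 2"
  let ?q = "\<lambda>i. real (order (F i))"
  let ?n = "\<lambda>i. real (card (E i))"
  let ?T = "\<lambda>i. real (card (congruence_classes (F i) d k (E i)))"
  let ?min = "\<lambda>s i. min (?q i powr real ?m) (?n i powr (real k - 1 + 4 * s) * ?q i powr (real ?m - real k * real d))"
  have space: "finite_field_character (F i) (\<chi> i)" if "i \<in> I" for i
    using assms(3,4,6) [OF that]
    by (simp add: finite_field_character_def finite_field_character_axioms_def
        finite_field_space_def finite_field_space_axioms_def)
  have q: "?q i \<ge> 1" if "i \<in> I" for i
  proof -
    interpret finite_field_character "F i" d "\<chi> i"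
      by (rule space [OF that])
    show ?thesis
      using q_pos by simp
  qed
  have main: "lesssim I (?min s) ?T" if salem: "salem4 I F \<chi> d s E" for s
  proof -
    obtain c where c: "c > 0" and norm4: "\<And>i. i \<in> I \<Longrightarrow>
        fourier_norm4 (F i) (\<chi> i) d (E i) \<le> c * (?q i powr (- real d) * ?n i powr (1 - s))"
      using salem unfolding salem4_def lesssim_def by blast
    \<comment> \<open>The constant involves only \<open>k\<close> and the Salem constant
      \<open>c\<close>, hence is the same for all members of the family.\<close>
    have "?min s i \<le> 2 ^ k * (2 ^ (k + 1) + 4 * c ^ 4) * ?T i" if i: "i \<in> I" for i
    proof (cases "card (E i) = 0")
      case True
      \<comment> \<open>For empty \<open>E i\<close> the second entry is zero, since
        \<open>0 powr a = 0\<close>.\<close>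
      then have "?min s i \<le> 0"
        by simp
      also have "0 \<le> 2 ^ k * (2 ^ (k + 1) + 4 * c ^ 4) * ?T i"
        by (intro mult_nonneg_nonneg add_nonneg_nonneg) auto
      finally show ?thesis .
    next
      case False
      interpret finite_field_character "F i" d "\<chi> i"
        by (rule space [OF i])
      \<comment> \<open>The variance bound for the incidence counts. The factor
        \<open>order (F i)\<close> to the power \<open>- d\<close> in the Salem condition cancels
        exactly against the normalization of the transform, so \<open>D\<close> is bounded by a
        power of the size of \<open>E i\<close> alone.\<close>
      define D where "D = (\<Sum>x\<in>V - {zv}. cmod (exp_sum (E i) x) ^ 4) / ?q i ^ d"
      have "D / ?q i ^ (4 * d) = fourier_norm4 (F i) (\<chi> i) d (E i) ^ 4"
        by (simp add: fourier_norm4_power4 D_def)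
      also have "\<dots> \<le> (c * (?q i powr (- real d) * ?n i powr (1 - s))) ^ 4"
        using norm4 [OF i] by (intro power_mono) (auto simp: fourier_norm4_def)
      also have "\<dots> = c ^ 4 * (?n i powr (1 - s)) ^ 4 / ?q i ^ (4 * d)"
        using q [OF i] by (simp add: powr_minus powr_realpow power_mult_distrib divide_inverse mult.commute
            power_inverse flip: power_mult)
      finally have D: "D \<le> c ^ 4 * (?n i powr (1 - s)) ^ 4"
        using q [OF i] by (simp add: divide_le_cancel)
      show ?thesis
        using False card_congruence_classes_ge [OF assms(7) [OF i] assms(5) [OF i] assms(1,2)]
          choose_le_mult [OF assms(2)]
        by (intro min_le_of_simplex_bound [where D = D, OF q [OF i] _ _ assms(1) _ D]) (auto simp: D_def)
    qed
    moreover have "2 ^ k * (2 ^ (k + 1) + 4 * c ^ 4) > 0"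
      using c by (intro mult_pos_pos add_pos_pos) auto
    ultimately show ?thesis
      unfolding lesssim_def by blast
  qed
  moreover have "lesssim I (\<lambda>i. ?q i powr real ?m) ?T"
    if dense: "lesssim I (\<lambda>i. ?q i powr (real k * real d / (real k + 1))) ?n"
      and salem: "salem4 I F \<chi> d (1/2) E"
  proof -
    obtain c where c: "c > 0" "\<And>i. i \<in> I \<Longrightarrow> ?q i powr (real k * real d / (real k + 1)) \<le> c * ?n i"
      using dense unfolding lesssim_def by blast
    obtain c' where c': "c' > 0" "\<And>i. i \<in> I \<Longrightarrow> ?min (1/2) i \<le> c' * ?T i"
      using main [OF salem] unfolding lesssim_def by blast
    have "?q i powr real ?m \<le> ((1 + c ^ (k + 1)) * c') * ?T i" if i: "i \<in> I" for i
    proof -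
      have "?q i powr real ?m \<le> (1 + c ^ (k + 1)) * ?min (1/2) i"
        by (rule powr_le_of_min_bound [OF q [OF i] c(1) c(2) [OF i]])
      also have "\<dots> \<le> (1 + c ^ (k + 1)) * (c' * ?T i)"
        using c'(2) [OF i] c(1) by (intro mult_left_mono) auto
      finally show ?thesis
        by (simp only: mult.assoc)
    qed
    moreover have "(1 + c ^ (k + 1)) * c' > 0"
      using c(1) c'(1) by (intro mult_pos_pos add_pos_pos) auto
    ultimately show ?thesis
      unfolding lesssim_def by blast
  qed
  ultimately show ?thesis
    by blast
qed

end
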